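(* For every $\beta>1$ there exists $1<\beta'<2$ such that the beta-shifts $\mathsf{X}_\beta$ and $\mathsf{X}_{\beta'}$ are flow equivalent.
   Context: For $\beta>1$, let $e(\beta)=x_1x_2\cdots$ be the $\beta$-expansion of $1$ ($x_1=\lfloor\beta\rfloor$, $r_1=\{\beta\}$, $x_n=\lfloor\beta r_{n-1}\rfloor$, $r_n=\{\beta r_{n-1}\}$). The beta-shift $\mathsf{X}_\beta$ is the two-sided shift space (with the left shift) whose language is the set of all words $x_n(t)\cdots x_m(t)$, $1\le n\le m$, occurring in $\beta$-expansions of numbers $t\in[0,1]$ (defined analogously with $r_1(t)=\{\beta t\}$, $x_1(t)=\lfloor\beta t\rfloor$). For a shift space $(X,\sigma)$, the suspension flow is $SX=X\times\mathbb{R}/\sim$ with $(x,t)\sim(\sigma(x),t-1)$, and $[x,t]+r=[x,t+r]$. Shift spaces $X,Y$ are flow equivalent if there is a homeomorphism $\Phi\colon SX\to SY$ such that for each $z\in SX$ there is a monotonically increasing $\varphi_z\colon\mathbb{R}\to\mathbb{R}$ with $\Phi(z+r)=\Phi(z)+\varphi_z(r)$ for all $r$. *)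

theory Defs
  imports "HOL-Analysis.Analysis"
begin

definition beta_orbit :: "real \<Rightarrow> real \<Rightarrow> nat \<Rightarrow> real" where
  "beta_orbit \<beta> t n = ((\<lambda>s. frac (\<beta> * s)) ^^ n) t"

text \<open>Digit number n (0-based): beta_digit b t n is x_(n+1)(t) = floor (beta * r_n(t)), r_0(t) = t.\<close>
definition beta_digit :: "real \<Rightarrow> real \<Rightarrow> nat \<Rightarrow> nat" where
  "beta_digit \<beta> t n = nat \<lfloor>\<beta> * beta_orbit \<beta> t n\<rfloor>"

definition beta_lang :: "real \<Rightarrow> nat list set" where
  "beta_lang \<beta> = {w. w \<noteq> [] \<and> (\<exists>t\<in>{0..1}. \<exists>n. w = map (beta_digit \<beta> t) [n..<n + length w])}"

definition shift_of_lang :: "nat list set \<Rightarrow> (int \<Rightarrow> nat) set" where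
  "shift_of_lang L = {x. \<forall>i j. i \<le> j \<longrightarrow> map (\<lambda>k. x (i + int k)) [0..<nat (j - i) + 1] \<in> L}"

definition beta_shift :: "real \<Rightarrow> (int \<Rightarrow> nat) set" where
  "beta_shift \<beta> = shift_of_lang (beta_lang \<beta>)"

definition shift_top :: "(int \<Rightarrow> nat) set \<Rightarrow> (int \<Rightarrow> nat) topology" where
  "shift_top X = subtopology (product_topology (\<lambda>_. discrete_topology UNIV) UNIV) X"

text \<open>Equivalence class [x,t] of (x,t) under (x,t) ~ (sigma x, t - 1), sigma the left shift.\<close>
definition susp_class :: "(int \<Rightarrow> nat) \<Rightarrow> real \<Rightarrow> ((int \<Rightarrow> nat) \<times> real) set" where
  "susp_class x t = {((\<lambda>i. x (i + n)), t - real_of_int n) | n::int. True}"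

definition susp_space :: "(int \<Rightarrow> nat) set \<Rightarrow> ((int \<Rightarrow> nat) \<times> real) set set" where
  "susp_space X = {susp_class x t | x t. x \<in> X}"

definition susp_top :: "(int \<Rightarrow> nat) set \<Rightarrow> ((int \<Rightarrow> nat) \<times> real) set topology" where
  "susp_top X = topology (\<lambda>U. U \<subseteq> susp_space X \<and>
      openin (prod_topology (shift_top X) euclideanreal)
        {p \<in> X \<times> UNIV. susp_class (fst p) (snd p) \<in> U})"

definition susp_add :: "((int \<Rightarrow> nat) \<times> real) set \<Rightarrow> real \<Rightarrow> ((int \<Rightarrow> nat) \<times> real) set" where
  "susp_add z r = {(x, t + r) | x t. (x, t) \<in> z}"

definition flow_equivalent :: "(int \<Rightarrow> nat) set \<Rightarrow> (int \<Rightarrow> nat) set \<Rightarrow> bool" where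
  "flow_equivalent X Y \<longleftrightarrow> (\<exists>\<Phi>. homeomorphic_map (susp_top X) (susp_top Y) \<Phi> \<and>
     (\<forall>z \<in> susp_space X. \<exists>\<phi> :: real \<Rightarrow> real. mono \<phi> \<and>
        (\<forall>r. \<Phi> (susp_add z r) = susp_add (\<Phi> z) (\<phi> r))))"

end

theory Submission
  imports Defs
begin

text \<open>
  Let \<open>d\<close> be the quasi-greedy expansion of 1 in base \<open>\<beta>\<close>. The beta-shift consists of the
  bi-infinite sequences all of whose right tails are lexicographically at most \<open>d\<close>, and every
  sequence with infinitely many nonzero digits that dominates its own tails is the quasi-greedy
  expansion of 1 in the base in which its value is 1.
  Replacing each digit \<open>a\<close> by the word \<open>1\<^sup>a 0\<close> preserves and reflects the lexicographic order.
  Hence the coded sequence \<open>d'\<close> again dominates its tails; it has digits 0 and 1 and contains a 0,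
  so its base \<open>\<beta>'\<close> lies strictly between 1 and 2. Runs of 1 in a sequence with all tails at
  most \<open>d'\<close> have length at most \<open>d 0\<close>, so such a sequence decodes uniquely, and the beta-shift
  of \<open>\<beta>'\<close> is the set of shifts of codes of points of the beta-shift of \<open>\<beta>\<close>. Stretching the unit
  time spent on the digit \<open>a\<close> to \<open>a + 1\<close> is then a flow equivalence.
\<close>

section \<open>Beta-shifts and lexicographic order\<close>

text \<open>The condition is trivial before the first difference of the two sequences and vacuous
  after it. This gives the non-strict lexicographic order without a case distinction between
  equality and a first difference.\<close>

definition lex_le :: "(nat \<Rightarrow> nat) \<Rightarrow> (nat \<Rightarrow> nat) \<Rightarrow> bool" where
  "lex_le a b \<longleftrightarrow> (\<forall>m. (\<forall>j<m. a j = b j) \<longrightarrow> a m \<le> b m)"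

definition lex_shift :: "(nat \<Rightarrow> nat) \<Rightarrow> (int \<Rightarrow> nat) set" where
  "lex_shift d = {x. \<forall>i. lex_le (\<lambda>j. x (i + int j)) d}"

lemma lex_le_first: "lex_le a b \<Longrightarrow> a 0 \<le> b 0"
  by (auto simp: lex_le_def)

primrec word_val :: "real \<Rightarrow> nat \<Rightarrow> (nat \<Rightarrow> nat) \<Rightarrow> real" where
  "word_val \<beta> 0 a = 0"
| "word_val \<beta> (Suc l) a = (real (a 0) + word_val \<beta> l (\<lambda>j. a (Suc j))) / \<beta>"

lemma word_val_eq_sum: "word_val \<beta> l a = (\<Sum>k<l. real (a k) / \<beta> ^ Suc k)"
proof (induction l arbitrary: a)
  case (Suc l)
  show ?case
    unfolding word_val.simps Suc sum.lessThan_Suc_shift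
    by (simp add: add_divide_distrib sum_divide_distrib mult.commute)
qed simp

lemma word_val_append:
  "word_val \<beta> (m + l) a = word_val \<beta> m a + word_val \<beta> l (\<lambda>j. a (m + j)) / \<beta> ^ m"
  by (induction m arbitrary: a) (simp_all add: add_divide_distrib mult.commute)

lemma word_val_cong: "(\<And>j. j < l \<Longrightarrow> a j = b j) \<Longrightarrow> word_val \<beta> l a = word_val \<beta> l b"
  by (simp add: word_val_eq_sum)

lemma word_val_nonneg: "\<beta> > 0 \<Longrightarrow> word_val \<beta> l a \<ge> 0"
  by (simp add: word_val_eq_sum sum_nonneg)

lemma word_val_Suc_right: "word_val \<beta> (Suc l) a = word_val \<beta> l a + real (a l) / \<beta> ^ Suc l"
  by (simp add: word_val_eq_sum del: word_val.simps)

lemma beta_orbit_Suc: "beta_orbit \<beta> t (Suc n) = frac (\<beta> * beta_orbit \<beta> t n)"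
  by (simp add: beta_orbit_def)

lemma beta_orbit_0 [simp]: "beta_orbit \<beta> t 0 = t"
  by (simp add: beta_orbit_def)

lemma beta_orbit_nonneg: "t \<ge> 0 \<Longrightarrow> beta_orbit \<beta> t n \<ge> 0"
  by (cases n) (simp_all add: beta_orbit_Suc)

lemma beta_orbit_step:
  assumes "\<beta> > 0" "t \<ge> 0"
  shows "\<beta> * beta_orbit \<beta> t n = real (beta_digit \<beta> t n) + beta_orbit \<beta> t (Suc n)"
  using assms beta_orbit_nonneg[OF assms(2), of \<beta> n]
  by (simp add: beta_digit_def beta_orbit_Suc frac_def)

text \<open>Unfolding \<open>beta_orbit_step\<close> l times writes the orbit point as the value of
  its next l digits plus a nonnegative remainder.\<close>

lemma word_val_le_beta_orbit:
  assumes "\<beta> > 0" "t \<ge> 0"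
  shows "word_val \<beta> l (\<lambda>j. beta_digit \<beta> t (n + j)) \<le> beta_orbit \<beta> t n"
proof (induction l arbitrary: n)
  case 0
  then show ?case using assms by (simp add: beta_orbit_nonneg)
next
  case (Suc l)
  then show ?case
    using beta_orbit_step[OF assms, of n] Suc[of "Suc n"] assms(1)
    by (simp add: field_simps)
qed

text \<open>
  Here \<open>d\<close> is the lexicographic supremum of the expansions of the numbers below 1. It equals
  the expansion of 1 unless that one is finite, say \<open>x\<^sub>1 \<dots> x\<^sub>n 0 0 \<dots>\<close>, in which case
  \<open>d\<close> is the periodic sequence with period \<open>x\<^sub>1 \<dots> (x\<^sub>n - 1)\<close>.
\<close>

locale quasi_greedy =
  fixes \<beta> :: real and d :: "nat \<Rightarrow> nat"
  assumes beta_gt_1: "1 < \<beta>"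
    and sums_1: "(\<lambda>k. real (d k) / \<beta> ^ Suc k) sums 1"
    and infinitely_many: "\<exists>m\<ge>n. d m \<noteq> 0"
    and tails_le: "lex_le (\<lambda>j. d (k + j)) d"
begin

text \<open>A nonzero digit at or beyond position l still contributes to the total 1, so the partial
  sum is strictly smaller.\<close>

lemma prefix_val_less_1: "word_val \<beta> l d < 1"
proof -
  obtain m where m: "m \<ge> l" "d m \<noteq> 0" using infinitely_many by blast
  have "word_val \<beta> l d = (\<Sum>k<l. real (d k) / \<beta> ^ Suc k)" by (rule word_val_eq_sum)
  also have "\<dots> \<le> (\<Sum>k<m. real (d k) / \<beta> ^ Suc k)"
    using m beta_gt_1 by (intro sum_mono2) auto
  also have "\<dots> < (\<Sum>k<Suc m. real (d k) / \<beta> ^ Suc k)"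
    using m beta_gt_1 by simp
  also have "\<dots> \<le> 1"
    using sum_le_suminf[OF sums_summable[OF sums_1], of "{..<Suc m}"] sums_unique[OF sums_1] beta_gt_1
    by simp
  finally show ?thesis .
qed

text \<open>At the first difference m the sequence a loses at least one unit against d. What follows
  has value less than 1, by induction on the length, and cannot make up for that unit. Without a
  difference before l the value is that of a prefix of d.\<close>

lemma word_val_less_1:
  assumes "\<And>k. lex_le (\<lambda>j. a (k + j)) d"
  shows "word_val \<beta> l a < 1"
  using assms
proof (induction l arbitrary: a rule: less_induct)
  case (less l)
  show ?case
  proof (cases "\<forall>j<l. a j = d j")
    case True
    then show ?thesis using prefix_val_less_1[of l] by (simp cong: word_val_cong)
  next
    case False
    define m where "m = (LEAST m. a m \<noteq> d m)"
    obtain j0 where j0: "j0 < l" "a j0 \<noteq> d j0" using False by blast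
    have am: "a m \<noteq> d m" unfolding m_def using j0(2) by (rule LeastI)
    have pre: "\<And>j. j < m \<Longrightarrow> a j = d j" unfolding m_def using not_less_Least by blast
    have ml: "m < l" using j0 pre[of j0] by linarith
    have "a m \<le> d m" using less.prems[of 0] pre by (simp add: lex_le_def)
    then have lt: "real (a m) + 1 \<le> real (d m)" using am by linarith
    define k where "k = l - Suc m"
    have l: "l = Suc m + k" using ml by (simp add: k_def)
    have tl: "word_val \<beta> k (\<lambda>j. a (Suc m + j)) < 1"
    proof (rule less.IH)
      show "k < l" using l by simp
      show "lex_le (\<lambda>j. a (Suc m + (i + j))) d" for i
        using less.prems[of "Suc m + i"] by (simp add: add.assoc)
    qed
    have "word_val \<beta> l a = word_val \<beta> (Suc m) a + word_val \<beta> k (\<lambda>j. a (Suc m + j)) / \<beta> ^ Suc m"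
      unfolding l by (rule word_val_append)
    also have "\<dots> = word_val \<beta> m d + (real (a m) + word_val \<beta> k (\<lambda>j. a (Suc m + j))) / \<beta> ^ Suc m"
      unfolding word_val_Suc_right using pre by (simp add: add_divide_distrib cong: word_val_cong)
    also have "\<dots> < word_val \<beta> m d + real (d m) / \<beta> ^ Suc m"
      using tl lt beta_gt_1 by (intro add_strict_left_mono divide_strict_right_mono) auto
    also have "\<dots> = word_val \<beta> (Suc m) d" by (simp only: word_val_Suc_right)
    also have "\<dots> < 1" by (rule prefix_val_less_1)
    finally show ?thesis .
  qed
qed

text \<open>Equivalently, every tail of \<open>d\<close> has value at most 1.\<close>

lemma one_le_prefix_val_plus: "1 \<le> word_val \<beta> m d + 1 / \<beta> ^ m"
proof (rule LIMSEQ_le_const2)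
  have "(\<lambda>l. word_val \<beta> l d) \<longlonglongrightarrow> 1"
    using sums_1 by (simp add: sums_def word_val_eq_sum)
  then show "(\<lambda>l. word_val \<beta> (l + m) d) \<longlonglongrightarrow> 1"
    by (rule LIMSEQ_ignore_initial_segment)
  have "word_val \<beta> (l + m) d \<le> word_val \<beta> m d + 1 / \<beta> ^ m" for l
  proof -
    have "word_val \<beta> l (\<lambda>j. d (m + j)) < 1"
      using tails_le[of "m + i" for i] by (intro word_val_less_1) (simp add: add.assoc)
    then show ?thesis
      using beta_gt_1 word_val_append[of \<beta> m l d]
      by (simp add: add.commute divide_right_mono)
  qed
  then show "\<exists>N. \<forall>l\<ge>N. word_val \<beta> (l + m) d \<le> word_val \<beta> m d + 1 / \<beta> ^ m" by blast
qed

text \<open>All tails of the word have value in [0, 1), so the greedy algorithm started at the value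
  of the word returns exactly its digits. Orbit and digit are treated together because each digit is
  read off the orbit point at the same index. At k = l the orbit has reached the empty word, and no
  digit is claimed.\<close>

lemma beta_expansion_of_word:
  assumes "\<And>k. lex_le (\<lambda>j. a (k + j)) d" and "k \<le> l"
  shows "beta_orbit \<beta> (word_val \<beta> l a) k = word_val \<beta> (l - k) (\<lambda>j. a (k + j))
    \<and> (k < l \<longrightarrow> beta_digit \<beta> (word_val \<beta> l a) k = a k)"
  using assms(2)
proof (induction k)
  \<comment> \<open>Multiplication by \<beta> moves the first digit in front of the point. The rest
    lies in [0, 1) and hence is the fractional part.\<close>
  have fl: "\<lfloor>\<beta> * word_val \<beta> (Suc n) b\<rfloor> = int (b 0)
      \<and> frac (\<beta> * word_val \<beta> (Suc n) b) = word_val \<beta> n (\<lambda>j. b (Suc j))"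
    if "word_val \<beta> n (\<lambda>j. b (Suc j)) < 1" for n b
  proof -
    have "\<beta> * word_val \<beta> (Suc n) b = real (b 0) + word_val \<beta> n (\<lambda>j. b (Suc j))"
      using beta_gt_1 by simp
    moreover have "word_val \<beta> n (\<lambda>j. b (Suc j)) \<ge> 0"
      using beta_gt_1 by (intro word_val_nonneg) simp
    ultimately show ?thesis using that by (simp add: frac_def floor_eq_iff)
  qed
  have tl: "word_val \<beta> n (\<lambda>j. a (k + Suc j)) < 1" for n k
    using assms(1)[of "Suc k + i" for i] by (intro word_val_less_1) (simp add: add.assoc)
  have dig: "beta_digit \<beta> (word_val \<beta> l a) k = a k
     \<and> beta_orbit \<beta> (word_val \<beta> l a) (Suc k) = word_val \<beta> (l - Suc k) (\<lambda>j. a (Suc k + j))"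
    if "k < l" "beta_orbit \<beta> (word_val \<beta> l a) k = word_val \<beta> (l - k) (\<lambda>j. a (k + j))" for k
  proof -
    have "l - k = Suc (l - Suc k)" using that by simp
    then show ?thesis
      using fl[of "l - Suc k" "\<lambda>j. a (k + j)", OF tl] that(2)
      by (simp add: beta_digit_def beta_orbit_Suc del: word_val.simps)
  qed
  {
    case 0
    then show ?case using dig[of 0] by auto
  next
    case (Suc k)
    then show ?case using dig[of k] dig[of "Suc k"] by simp
  }
qed

text \<open>A word read in a point of \<open>lex_shift d\<close> starts the expansion of its own
  value, so it belongs to the language. Conversely, a word that exceeds d at the first difference
  has value at least 1, too much for an orbit point that is a fractional part.\<close>

theorem beta_shift_eq: "beta_shift \<beta> = lex_shift d"
proof
  show "lex_shift d \<subseteq> beta_shift \<beta>"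
  proof
    fix x assume x: "x \<in> lex_shift d"
    show "x \<in> beta_shift \<beta>"
      unfolding beta_shift_def shift_of_lang_def
    proof (intro CollectI allI impI)
      fix i j :: int assume "i \<le> j"
      define l where "l = nat (j - i) + 1"
      define a where "a = (\<lambda>k. x (i + int k))"
      have a: "lex_le (\<lambda>j. a (k + j)) d" for k
        using x by (auto simp: lex_shift_def a_def add.assoc[symmetric])
      define t where "t = word_val \<beta> l a"
      have "t < 1" unfolding t_def using a by (rule word_val_less_1)
      moreover have "t \<ge> 0" unfolding t_def using beta_gt_1 by (intro word_val_nonneg) simp
      moreover have "map a [0..<l] = map (beta_digit \<beta> t) [0..<0 + l]"
        using beta_expansion_of_word[OF a] by (simp add: t_def)
      ultimately have "map a [0..<l] \<in> beta_lang \<beta>"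
        unfolding beta_lang_def l_def by (auto intro!: bexI[of _ t] exI[of _ 0])
      then show "map (\<lambda>k. x (i + int k)) [0..<nat (j - i) + 1] \<in> beta_lang \<beta>"
        by (simp only: a_def l_def)
    qed
  qed
  show "beta_shift \<beta> \<subseteq> lex_shift d"
  proof
    fix x assume x: "x \<in> beta_shift \<beta>"
    have "x (i + int m) \<le> d m" if eq: "\<forall>j<m. x (i + int j) = d j" for i m
    proof (rule ccontr)
      assume "\<not> x (i + int m) \<le> d m"
      then have gt: "real (d m) + 1 \<le> real (x (i + int m))" by linarith
      \<comment> \<open>The word begins one position before i. The digits compared with d then start
        at index \<open>Suc n\<close>, where the orbit point is a fractional part and thus below 1;
        the starting number t itself may be 1.\<close>
      define w where "w = map (\<lambda>k. x (i - 1 + int k)) [0..<m + 2]"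
      have "map (\<lambda>k. x (i - 1 + int k)) [0..<nat ((i + int m) - (i - 1)) + 1] \<in> beta_lang \<beta>"
        using x unfolding beta_shift_def shift_of_lang_def mem_Collect_eq
        by (elim allE[of _ "i - 1"] allE[of _ "i + int m"] impE) simp_all
      then have "w \<in> beta_lang \<beta>" by (simp add: w_def nat_add_distrib)
      then obtain t n where t: "0 \<le> t" "t \<le> 1" and w: "w = map (beta_digit \<beta> t) [n..<n + (m + 2)]"
        unfolding beta_lang_def by (auto simp: w_def)
      have dig: "beta_digit \<beta> t (Suc n + j) = x (i + int j)" if "j \<le> m" for j
      proof -
        have "w ! Suc j = x (i + int j)" using that by (simp add: w_def del: upt_Suc)
        moreover have "w ! Suc j = beta_digit \<beta> t (Suc n + j)"
          using that unfolding w by (subst nth_map) (simp_all del: upt_Suc)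
        ultimately show ?thesis by simp
      qed
      \<comment> \<open>One extra unit at position m is worth at least all of d after m, so the word
        reaches the value 1.\<close>
      have "1 \<le> word_val \<beta> (Suc m) d + 1 / \<beta> ^ Suc m" by (rule one_le_prefix_val_plus)
      also have "\<dots> = word_val \<beta> m d + (real (d m) + 1) / \<beta> ^ Suc m"
        by (simp only: word_val_Suc_right add_divide_distrib add.assoc)
      also have "\<dots> \<le> word_val \<beta> m d + real (x (i + int m)) / \<beta> ^ Suc m"
        using gt beta_gt_1 by (intro add_left_mono divide_right_mono) auto
      also have "\<dots> = word_val \<beta> (Suc m) (\<lambda>j. x (i + int j))"
        unfolding word_val_Suc_right using eq by (simp cong: word_val_cong)
      also have "\<dots> = word_val \<beta> (Suc m) (\<lambda>j. beta_digit \<beta> t (Suc n + j))"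
        by (rule word_val_cong) (simp add: dig[symmetric])
      also have "\<dots> \<le> beta_orbit \<beta> t (Suc n)"
        using beta_gt_1 t by (intro word_val_le_beta_orbit) auto
      also have "\<dots> < 1" by (simp add: beta_orbit_Suc frac_lt_1)
      finally show False by simp
    qed
    then show "x \<in> lex_shift d" by (simp add: lex_shift_def lex_le_def)
  qed
qed

end

section \<open>Existence of quasi-greedy expansions and of bases\<close>

primrec ceil_orbit :: "real \<Rightarrow> nat \<Rightarrow> real" where
  "ceil_orbit \<beta> 0 = 1"
| "ceil_orbit \<beta> (Suc n) = \<beta> * ceil_orbit \<beta> n - of_int (\<lceil>\<beta> * ceil_orbit \<beta> n\<rceil> - 1)"

lemma ceil_orbit_bounds: "0 < ceil_orbit \<beta> n \<and> ceil_orbit \<beta> n \<le> 1"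
  by (cases n) (simp_all, linarith)

text \<open>\<open>ceil_orbit\<close> follows 1 under the variant of the greedy map with values in
  (0, 1] instead of [0, 1). The digits are the integers subtracted on the way. Since the orbit never
  hits 0, the expansion cannot end in zeros.\<close>

lemma quasi_greedy_exists:
  assumes "1 < \<beta>"
  shows "\<exists>d. quasi_greedy \<beta> d"
proof -
  define s where "s = ceil_orbit \<beta>"
  define d where "d = (\<lambda>n. nat (\<lceil>\<beta> * s n\<rceil> - 1))"
  have s: "0 < s n" "s n \<le> 1" for n using ceil_orbit_bounds by (auto simp: s_def)
  have "\<lceil>\<beta> * s n\<rceil> \<ge> 1" for n
    using s[of n] assms by (simp add: one_le_ceiling)
  then have d: "int (d n) = \<lceil>\<beta> * s n\<rceil> - 1" for n by (simp add: d_def)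
  have step: "\<beta> * s n = real (d n) + s (Suc n)" for n
  proof -
    have "real (d n) = of_int (int (d n))" by simp
    then show ?thesis unfolding d by (simp add: s_def)
  qed
  have part: "(\<Sum>k<n. real (d k) / \<beta> ^ Suc k) = 1 - s n / \<beta> ^ n" for n
  proof (induction n)
    case 0
    then show ?case by (simp add: s_def)
  next
    case (Suc n)
    have "real (d n) = \<beta> * s n - s (Suc n)" using step[of n] by simp
    then have "real (d n) / \<beta> ^ Suc n = s n / \<beta> ^ n - s (Suc n) / \<beta> ^ Suc n"
      using assms by (simp add: diff_divide_distrib)
    then show ?case using Suc by (simp del: power_Suc)
  qed
  have "(\<lambda>n. s n / \<beta> ^ n) \<longlonglongrightarrow> 0"
  proof (rule tendsto_sandwich[of "\<lambda>_. 0" _ _ "\<lambda>n. (1 / \<beta>) ^ n"])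
    show "\<forall>\<^sub>F n in sequentially. 0 \<le> s n / \<beta> ^ n"
      using s assms by (intro always_eventually allI) (simp add: less_imp_le)
    show "\<forall>\<^sub>F n in sequentially. s n / \<beta> ^ n \<le> (1 / \<beta>) ^ n"
      using s assms by (intro always_eventually allI) (simp add: power_one_over divide_simps)
    show "(\<lambda>n. (1 / \<beta>) ^ n) \<longlonglongrightarrow> 0" using assms by (intro LIMSEQ_realpow_zero) auto
  qed simp
  then have "(\<lambda>n. 1 - s n / \<beta> ^ n) \<longlonglongrightarrow> 1 - 0" by (intro tendsto_intros)
  then have sums: "(\<lambda>k. real (d k) / \<beta> ^ Suc k) sums 1"
    unfolding sums_def part by simp
  have inf: "\<exists>m\<ge>n. d m \<noteq> 0" for n
  proof (rule ccontr)
    assume "\<not> (\<exists>m\<ge>n. d m \<noteq> 0)"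
    \<comment> \<open>With only zero digits left the orbit grows by the factor \<beta> > 1 at each
      step, but it is bounded by 1.\<close>
    then have "s (Suc (n + j)) = \<beta> * s (n + j)" for j using step[of "n + j"] by simp
    then have "s (n + j) = \<beta> ^ j * s n" for j
      by (induction j) simp_all
    then have le: "\<beta> ^ j * s n \<le> 1" for j using s[of "n + j"] by simp
    obtain j where "1 / s n < \<beta> ^ j" using real_arch_pow[OF assms] by blast
    then show False using s[of n] le[of j] by (simp add: pos_divide_less_eq)
  qed
  have "lex_le (\<lambda>j. d (k + j)) d" for k
    unfolding lex_le_def
  proof (intro allI impI)
    fix m assume eq: "\<forall>j<m. d (k + j) = d j"
    \<comment> \<open>The orbit starts at its largest possible value 1. While the digits agree, both
      points move under the same increasing affine map, so their order persists and decides the next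
      digit.\<close>
    have "s (k + j) \<le> s j" if "j \<le> m" for j
      using that
    proof (induction j)
      case 0
      then show ?case using s by (simp add: s_def)
    next
      case (Suc j)
      then have "\<beta> * s (k + j) \<le> \<beta> * s j" using assms by simp
      then show ?case using step[of "k + j"] step[of j] eq Suc.prems by simp
    qed
    then have "\<beta> * s (k + m) \<le> \<beta> * s m" using assms by simp
    then show "d (k + m) \<le> d m" unfolding d_def by (intro nat_mono diff_right_mono ceiling_mono)
  qed
  then show ?thesis using assms sums inf by (auto simp: quasi_greedy_def)
qed

text \<open>For q = 1/\<beta> the value of d is \<open>q * g q\<close>, and the intermediate value
  theorem solves \<open>q * g q = 1\<close>. At q = 1/2 the all-ones sequence has value 1, so the
  zero digit at z pushes d strictly below. Near q = 1 two digits 1 already give more than 1.\<close>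

lemma quasi_greedy_base_exists:
  assumes le1: "\<And>n. d n \<le> 1" and z: "d z = 0" and d0: "d 0 = 1"
    and inf: "\<And>n. \<exists>m\<ge>n. d m \<noteq> 0"
    and tails: "\<And>k. lex_le (\<lambda>j. d (k + j)) d"
  shows "\<exists>\<beta>. 1 < \<beta> \<and> \<beta> < 2 \<and> quasi_greedy \<beta> d"
proof -
  define g where "g = (\<lambda>z::real. \<Sum>n. real (d n) * z ^ n)"
  have bound: "real (d n) * r ^ n \<le> r ^ n" if "0 \<le> r" for n r
    using le1[of n] that by (simp add: mult_left_le_one_le)
  have sm: "summable (\<lambda>n. real (d n) * r ^ n)" if "0 \<le> r" "r < 1" for r
    by (rule summable_comparison_test[of _ "\<lambda>n. r ^ n"])
      (use bound that in \<open>auto intro!: summable_geometric\<close>)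
  have cont: "isCont g r" if "0 \<le> r" "r < 1" for r
    unfolding g_def
    by (rule isCont_powser[OF sm[of "(1 + r) / 2"]]) (use that in auto)
  have half: "(1/2) * g (1/2) < 1"
  proof -
    have geo: "(\<lambda>n. (1/2::real) ^ n) sums 2" using geometric_sums[of "1/2::real"] by simp
    have "(\<lambda>n. real (d n) * (1/2) ^ n) sums g (1/2)"
      unfolding g_def by (rule summable_sums[OF sm]) auto
    then have df: "(\<lambda>n. (1/2) ^ n - real (d n) * (1/2) ^ n) sums (2 - g (1/2))"
      by (rule sums_diff[OF geo])
    have "0 < (\<Sum>n. (1/2) ^ n - real (d n) * (1/2) ^ n)"
      using z bound[of "1/2"] by (intro suminf_pos2[OF sums_summable[OF df], of z]) auto
    then show ?thesis using sums_unique[OF df] by simp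
  qed
  \<comment> \<open>This is a second digit 1 besides \<open>d 0\<close>. The two together contribute
    r(1 + r^N), which tends to 2 as r tends to 1.\<close>
  obtain N where N: "N \<ge> 1" "d N = 1" using inf[of 1] le1 by (metis One_nat_def le_antisym less_one not_le)
  have "((\<lambda>r::real. r * (1 + r ^ N)) \<longlongrightarrow> 1 * (1 + 1 ^ N)) (at_left 1)"
    by (intro tendsto_intros)
  then have "\<forall>\<^sub>F r in at_left 1. (1::real) < r * (1 + r ^ N)"
    by (rule order_tendstoD) simp
  moreover have "\<forall>\<^sub>F r in at_left 1. r \<in> {1/2<..<1::real}"
    by (rule eventually_at_left_real) simp
  ultimately have "\<forall>\<^sub>F r in at_left (1::real). 1 < r * (1 + r ^ N) \<and> r \<in> {1/2<..<1}"
    by (rule eventually_conj)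
  then obtain r :: real where r: "1 < r * (1 + r ^ N)" "1/2 < r" "r < 1"
    using eventually_happens'[OF trivial_limit_at_left_real] by fastforce
  have "1 + r ^ N = (\<Sum>n\<in>{0, N}. real (d n) * r ^ n)" using N d0 by simp
  also have "\<dots> \<le> g r"
    unfolding g_def using r by (intro sum_le_suminf sm) auto
  finally have "1 < r * g r" using r mult_left_mono[of "1 + r ^ N" "g r" r] by linarith
  then have "\<exists>q\<ge>1/2. q \<le> r \<and> q * g q = 1"
    using half r by (intro IVT) (auto intro!: continuous_intros cont)
  then obtain q where q: "1/2 \<le> q" "q \<le> r" "q * g q = 1" by blast
  have q2: "1/2 < q" using q half by (cases "q = 1/2") auto
  have "(\<lambda>n. q * (real (d n) * q ^ n)) sums (q * g q)"
    unfolding g_def using q r by (intro sums_mult summable_sums sm) auto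
  then have "(\<lambda>n. real (d n) / (1 / q) ^ Suc n) sums 1"
    using q q2 by (simp add: power_divide mult_ac)
  moreover have "1 < 1 / q" "1 / q < 2" using q q2 r by (auto simp: field_simps)
  ultimately show ?thesis
    using inf tails by (intro exI[of _ "1 / q"]) (simp add: quasi_greedy_def)
qed

section \<open>The unary code\<close>

text \<open>The word \<open>1^a 0\<close> is never empty, so the position j drops at each call. This
  lets the recursion run along an infinite sequence of digits.\<close>

fun unary_code :: "(nat \<Rightarrow> nat) \<Rightarrow> nat \<Rightarrow> nat" where
  "unary_code a j = (if j < a 0 then 1 else if j = a 0 then 0
     else unary_code (\<lambda>i. a (Suc i)) (j - Suc (a 0)))"

declare unary_code.simps [simp del]

lemma unary_code_less [simp]: "j < a 0 \<Longrightarrow> unary_code a j = 1"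
  by (simp add: unary_code.simps)

lemma unary_code_eq [simp]: "j = a 0 \<Longrightarrow> unary_code a j = 0"
  by (simp add: unary_code.simps)

lemma unary_code_tail: "unary_code a (Suc (a 0 + j)) = unary_code (\<lambda>i. a (Suc i)) j"
  by (subst unary_code.simps) simp

lemma unary_code_cases:
  obtains (less) "j < a 0" | (eq) "j = a 0" | (tail) k where "j = Suc (a 0 + k)"
  by (metis add_Suc less_imp_Suc_add linorder_neqE_nat)

lemma unary_code_le_1: "unary_code a j \<le> 1"
proof (induction a j rule: unary_code.induct)
  case (1 a j)
  then show ?case by (subst unary_code.simps) auto
qed

text \<open>If \<open>a 0 < b 0\<close>, the codes first differ at position \<open>a 0\<close>,
  where the block of a has its final 0 and that of b still has a 1. If the first digits are equal,
  the common block is removed and the induction goes on with a smaller position.\<close>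

lemma lex_le_unary_code_imp:
  assumes "lex_le a b" shows "lex_le (unary_code a) (unary_code b)"
proof -
  have "unary_code a m \<le> unary_code b m"
    if "lex_le a b" "\<forall>j<m. unary_code a j = unary_code b j" for m
    using that
  proof (induction m arbitrary: a b rule: less_induct)
    case (less m)
    have le: "a 0 \<le> b 0" using less.prems(1) by (rule lex_le_first)
    show ?case
    proof (cases "a 0 = b 0")
      case False
      then have lt: "a 0 < b 0" using le by simp
      have "unary_code a (a 0) \<noteq> unary_code b (a 0)" using lt by simp
      then have "m \<le> a 0" using less.prems(2) by (metis not_le)
      then show ?thesis using lt unary_code_le_1[of a m] by simp
    next
      case True
      show ?thesis
      proof (cases m a rule: unary_code_cases)
        case (tail k)
        have "unary_code (\<lambda>i. a (Suc i)) k \<le> unary_code (\<lambda>i. b (Suc i)) k"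
        proof (rule less.IH)
          show "k < m" using tail by simp
          show "lex_le (\<lambda>i. a (Suc i)) (\<lambda>i. b (Suc i))"
            unfolding lex_le_def
          proof (intro allI impI)
            fix i assume "\<forall>j<i. a (Suc j) = b (Suc j)"
            then have "\<forall>j<Suc i. a j = b j" using True by (simp add: All_less_Suc2)
            then show "a (Suc i) \<le> b (Suc i)" using less.prems(1) by (simp add: lex_le_def)
          qed
          show "\<forall>j<k. unary_code (\<lambda>i. a (Suc i)) j = unary_code (\<lambda>i. b (Suc i)) j"
          proof (intro allI impI)
            fix j assume "j < k"
            then have "unary_code a (Suc (a 0 + j)) = unary_code b (Suc (b 0 + j))"
              using less.prems(2) tail True by simp
            then show "unary_code (\<lambda>i. a (Suc i)) j = unary_code (\<lambda>i. b (Suc i)) j"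
              by (simp add: unary_code_tail)
          qed
        qed
        then show ?thesis using tail True unary_code_tail[of a k] unary_code_tail[of b k] by simp
      qed (use True unary_code_eq[of _ b] in auto)
    qed
  qed
  then show ?thesis using assms by (simp add: lex_le_def)
qed

text \<open>This induction runs over digits instead of positions. If \<open>a 0\<close> exceeded
  \<open>b 0\<close>, the codes would agree up to position \<open>b 0\<close> and there have 1
  against 0, contrary to the assumption.\<close>

lemma lex_le_unary_code_D:
  assumes "lex_le (unary_code a) (unary_code b)" shows "lex_le a b"
proof -
  have "a m \<le> b m"
    if "lex_le (unary_code a) (unary_code b)" "\<forall>j<m. a j = b j" for m
    using that
  proof (induction m arbitrary: a b)
    case 0
    show ?case
    proof (rule ccontr)
      assume "\<not> a 0 \<le> b 0"
      then have "\<forall>j<b 0. unary_code a j = unary_code b j" "unary_code a (b 0) = 1" by auto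
      moreover from this have "unary_code a (b 0) \<le> unary_code b (b 0)"
        using 0(1) unfolding lex_le_def by blast
      ultimately show False by simp
    qed
  next
    case (Suc m)
    have e: "a 0 = b 0" using Suc.prems by simp
    have "lex_le (unary_code (\<lambda>i. a (Suc i))) (unary_code (\<lambda>i. b (Suc i)))"
      unfolding lex_le_def
    proof (intro allI impI)
      fix n assume h: "\<forall>j<n. unary_code (\<lambda>i. a (Suc i)) j = unary_code (\<lambda>i. b (Suc i)) j"
      have "unary_code a j = unary_code b j" if "j < Suc (a 0 + n)" for j
      proof (cases j a rule: unary_code_cases)
        case (tail k)
        then show ?thesis
          using h that e unary_code_tail[of a k] unary_code_tail[of b k] by simp
      qed (use e unary_code_eq[of _ b] in auto)
      then have "unary_code a (Suc (a 0 + n)) \<le> unary_code b (Suc (a 0 + n))"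
        using Suc.prems(1) by (simp add: lex_le_def)
      then show "unary_code (\<lambda>i. a (Suc i)) n \<le> unary_code (\<lambda>i. b (Suc i)) n"
        using unary_code_tail[of a n] unary_code_tail[of b n] e by simp
    qed
    then show ?case using Suc.IH[of "\<lambda>i. a (Suc i)" "\<lambda>i. b (Suc i)"] Suc.prems(2) by simp
  qed
  then show ?thesis using assms by (simp add: lex_le_def)
qed

lemma lex_le_unary_code_iff: "lex_le (unary_code a) (unary_code b) \<longleftrightarrow> lex_le a b"
  using lex_le_unary_code_imp lex_le_unary_code_D by blast

text \<open>A tail of a code that starts inside a block sees only part of the first digit; this
  lemma handles the shortened digit. Once the new digit equals \<open>b 0\<close>, nothing has been
  lowered, because \<open>b 0\<close> bounds \<open>a 0\<close>.\<close>

lemma lex_le_decrease_first: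
  assumes "lex_le a b" "k \<le> a 0" shows "lex_le (a(0 := k)) b"
  unfolding lex_le_def
proof (intro allI impI)
  fix m assume h: "\<forall>j<m. (a(0 := k)) j = b j"
  show "(a(0 := k)) m \<le> b m"
  proof (cases m)
    case 0
    then show ?thesis using assms lex_le_first[of a b] by simp
  next
    case (Suc l)
    then have "k = b 0" using h by auto
    then have "a 0 = k" using assms lex_le_first[of a b] by simp
    then have "a(0 := k) = a" by auto
    then show ?thesis using h assms(1) by (simp add: lex_le_def)
  qed
qed

text \<open>Position i lies in the block of some digit \<open>a n\<close>, and k is the number of
  ones left in that block from i on.\<close>

lemma unary_code_suffix:
  "\<exists>n k. k \<le> a n \<and> (\<lambda>j. unary_code a (i + j)) = unary_code ((\<lambda>j. a (n + j))(0 := k))"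
proof (induction i arbitrary: a rule: less_induct)
  case (less i)
  show ?case
  proof (cases "i \<le> a 0")
    case True
    define b where "b = a(0 := a 0 - i)"
    have b0: "b 0 = a 0 - i" and bS: "(\<lambda>i. b (Suc i)) = (\<lambda>i. a (Suc i))" by (simp_all add: b_def)
    have "unary_code a (i + j) = unary_code b j" for j
    proof (cases j b rule: unary_code_cases)
      case less
      then show ?thesis using True by (simp add: b0)
    next
      case eq
      then have "i + j = a 0" using True by (simp add: b0)
      then show ?thesis using eq by simp
    next
      case (tail k)
      then have "i + j = Suc (a 0 + k)" using True by (simp add: b0)
      then show ?thesis using tail by (simp only: unary_code_tail bS)
    qed
    then have "(\<lambda>j. unary_code a (i + j)) = unary_code ((\<lambda>j. a (0 + j))(0 := a 0 - i))"
      by (simp add: b_def)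
    then show ?thesis by (metis diff_le_self)
  next
    case False
    then obtain i' where i': "i = Suc (a 0 + i')" by (metis less_imp_Suc_add not_le)
    obtain n k where nk: "k \<le> a (Suc n)"
      "(\<lambda>j. unary_code (\<lambda>i. a (Suc i)) (i' + j)) = unary_code ((\<lambda>j. a (Suc (n + j)))(0 := k))"
      using less.IH[of i' "\<lambda>i. a (Suc i)"] i' by fastforce
    have "unary_code a (i + j) = unary_code (\<lambda>i. a (Suc i)) (i' + j)" for j
      using unary_code_tail[of a "i' + j"] by (simp add: i' add.assoc)
    then have "(\<lambda>j. unary_code a (i + j)) = unary_code ((\<lambda>j. a (Suc n + j))(0 := k))"
      using nk(2) by simp
    then show ?thesis using nk(1) by blast
  qed
qed

lemma unary_code_tails_le:
  assumes "\<And>k. lex_le (\<lambda>j. d (k + j)) d"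
  shows "lex_le (\<lambda>j. unary_code d (i + j)) (unary_code d)"
proof -
  obtain n k where nk: "k \<le> d n"
    "(\<lambda>j. unary_code d (i + j)) = unary_code ((\<lambda>j. d (n + j))(0 := k))"
    using unary_code_suffix by blast
  have "lex_le ((\<lambda>j. d (n + j))(0 := k)) d"
    using assms[of n] nk(1) by (intro lex_le_decrease_first) auto
  then show ?thesis unfolding nk(2) by (rule lex_le_unary_code_imp)
qed

lemma unary_code_infinitely_many:
  assumes "\<And>n. \<exists>m\<ge>n. d m \<noteq> 0"
  shows "\<exists>m\<ge>i. unary_code d m \<noteq> 0"
proof (rule ccontr)
  assume "\<not> ?thesis"
  then have z: "unary_code d (i + j) = 0" for j by simp
  obtain n k where nk:
    "(\<lambda>j. unary_code d (i + j)) = unary_code ((\<lambda>j. d (n + j))(0 := k))"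
    using unary_code_suffix by blast
  \<comment> \<open>The block of a nonzero digit begins with a 1, so a code that vanishes everywhere
    comes from zero digits only. Applied to a tail of d, this contradicts the infinitely many
    nonzero digits.\<close>
  have zero: "b m = 0" if "\<And>j. unary_code b j = 0" for b m
    using that
  proof (induction m arbitrary: b)
    case 0
    then show ?case by (metis gr0I unary_code_less zero_neq_one)
  next
    case (Suc m)
    have "unary_code (\<lambda>i. b (Suc i)) j = 0" for j
      using Suc.prems unary_code_tail[of b j] by simp
    then show ?case by (rule Suc.IH)
  qed
  have "((\<lambda>j. d (n + j))(0 := k)) m = 0" for m
    by (rule zero) (simp only: z flip: nk)
  from this[of "Suc m" for m] have "d (n + Suc m) = 0" for m by simp
  moreover obtain m where "m \<ge> Suc n" "d m \<noteq> 0" using assms by blast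
  moreover from this have "m = n + Suc (m - Suc n)" by simp
  ultimately show False by (metis (no_types))
qed

lemma quasi_greedy_unary_code:
  assumes "quasi_greedy \<beta> d"
  shows "\<exists>\<beta>'. 1 < \<beta>' \<and> \<beta>' < 2 \<and> quasi_greedy \<beta>' (unary_code d)"
proof -
  interpret quasi_greedy \<beta> d by fact
  \<comment> \<open>Comparing the first entries of the tails with d shows that \<open>d 0\<close> is
    the largest digit. It is nonzero, so the code starts with 1, and the code has its first 0 at
    position \<open>d 0\<close>.\<close>
  have "d 0 \<noteq> 0"
  proof
    assume d0: "d 0 = 0"
    obtain m where "d m \<noteq> 0" using infinitely_many by blast
    then show False using lex_le_first[OF tails_le[of m]] d0 by simp
  qed
  then show ?thesis
    using infinitely_many tails_le
    by (intro quasi_greedy_base_exists[of _ "d 0"] unary_code_le_1 unary_code_infinitely_many unary_code_tails_le) auto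
qed

section \<open>The bi-infinite code\<close>

text \<open>
  The bi-infinite code uses blocks \<open>0 1\<^sup>a\<close> rather than \<open>1\<^sup>a 0\<close>, so that the block of
  \<open>x n\<close> starts at the zero in position \<open>zero_pos x n\<close>, and the block of \<open>x 0\<close> at position 0.
\<close>

definition zero_pos :: "(int \<Rightarrow> nat) \<Rightarrow> int \<Rightarrow> int" where
  "zero_pos x n = (if 0 \<le> n then \<Sum>i\<in>{0..<n}. int (x i) + 1 else - (\<Sum>i\<in>{n..<0}. int (x i) + 1))"

lemma zero_pos_0 [simp]: "zero_pos x 0 = 0"
  by (simp add: zero_pos_def)

lemma zero_pos_add_1: "zero_pos x (n + 1) = zero_pos x n + int (x n) + 1"
proof -
  consider "0 \<le> n" | "n = -1" | "n < -1" by linarith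
  then show ?thesis
  proof cases
    case 1
    then have "{0..<n + 1} = insert n {0..<n}" by auto
    then show ?thesis using 1 by (simp add: zero_pos_def)
  next
    case 2
    have "{-1..<0} = {-1::int}" by auto
    then show ?thesis using 2 by (simp add: zero_pos_def)
  next
    case 3
    then have "{n..<0} = insert n {n + 1..<0}" by auto
    then show ?thesis using 3 by (simp add: zero_pos_def)
  qed
qed

lemma zero_pos_unique:
  assumes "f 0 = 0" "\<And>n. f (n + 1) = f n + int (x n) + 1"
  shows "f n = zero_pos x n"
proof (induction n rule: int_induct[where k = 0])
  case (step2 i)
  then show ?case using assms(2)[of "i - 1"] zero_pos_add_1[of x "i - 1"] by simp
qed (use assms in \<open>simp_all add: zero_pos_add_1\<close>)

lemma zero_pos_shift: "zero_pos (\<lambda>i. x (i + m)) n = zero_pos x (n + m) - zero_pos x m"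
  by (rule zero_pos_unique[symmetric]) (use zero_pos_add_1[of x "n + m" for n] in \<open>simp_all add: algebra_simps\<close>)

lemma zero_pos_gap: "n \<le> m \<Longrightarrow> zero_pos x n + (m - n) \<le> zero_pos x m"
  by (induction m rule: int_ge_induct) (simp_all add: zero_pos_add_1)

lemma zero_pos_gap_le:
  assumes "\<And>i. x i \<le> K" "n \<le> m"
  shows "zero_pos x m \<le> zero_pos x n + (int K + 1) * (m - n)"
  using assms(2)
proof (induction m rule: int_ge_induct)
  case (step i)
  have "(int K + 1) * (i + 1 - n) = (int K + 1) * (i - n) + (int K + 1)"
    by (simp add: algebra_simps)
  then show ?case using step assms(1)[of i] by (simp add: zero_pos_add_1)
qed simp

lemma zero_pos_less_iff: "zero_pos x n < zero_pos x m \<longleftrightarrow> n < m"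
  using zero_pos_gap[of n m x] zero_pos_gap[of m n x] by linarith

text \<open>The intervals are closed on the right to fit the one-sided code: from just after one
  zero up to the next one reads \<open>1^a 0\<close>.\<close>

lemma zero_pos_cover: "\<exists>n. zero_pos x n < i \<and> i \<le> zero_pos x (n + 1)"
proof -
  \<comment> \<open>Consecutive zeros are at least 1 apart, so the zeros with indices
    \<open>- \<bar>i\<bar> - 1\<close> and \<open>\<bar>i\<bar>\<close> enclose i.\<close>
  have "zero_pos x (- \<bar>i\<bar> - 1) < i" using zero_pos_gap[of "- \<bar>i\<bar> - 1" 0 x] by simp linarith
  moreover have "i \<le> zero_pos x (- \<bar>i\<bar> - 1 + int (nat (2 * \<bar>i\<bar> + 1)))"
    using zero_pos_gap[of 0 "\<bar>i\<bar>" x] by simp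
  moreover have "\<exists>n. zero_pos x n < i \<and> i \<le> zero_pos x (n + 1)"
    if "zero_pos x a < i" "i \<le> zero_pos x (a + int k)" for a k
    using that
  proof (induction k)
    case (Suc k)
    then show ?case by (cases "i \<le> zero_pos x (a + int k)") (auto simp: add_ac intro!: exI[of _ "a + int k"])
  qed simp
  ultimately show ?thesis by blast
qed

definition two_sided_code :: "(int \<Rightarrow> nat) \<Rightarrow> int \<Rightarrow> nat" where
  "two_sided_code x j = (if j \<in> range (zero_pos x) then 0 else 1)"

lemma two_sided_code_zero_pos [simp]: "two_sided_code x (zero_pos x n) = 0"
  by (simp add: two_sided_code_def)

lemma two_sided_code_0 [simp]: "two_sided_code x 0 = 0"
  using two_sided_code_zero_pos[of x 0] by simp

lemma two_sided_code_eq_0_iff: "two_sided_code x j = 0 \<longleftrightarrow> (\<exists>n. j = zero_pos x n)"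
  by (auto simp: two_sided_code_def)

lemma two_sided_code_between:
  assumes "zero_pos x n < j" "j < zero_pos x (n + 1)"
  shows "two_sided_code x j = 1"
proof -
  have "j \<noteq> zero_pos x m" for m
    using assms zero_pos_less_iff[of x n m] zero_pos_less_iff[of x m "n + 1"] by auto
  then show ?thesis by (auto simp: two_sided_code_def)
qed

lemma two_sided_code_shift:
  "two_sided_code (\<lambda>i. x (i + m)) = (\<lambda>j. two_sided_code x (j + zero_pos x m))"
proof
  fix j
  have "(\<exists>n. j = zero_pos x (n + m) - zero_pos x m) \<longleftrightarrow> (\<exists>n. j + zero_pos x m = zero_pos x n)"
    by (metis diff_add_cancel add_diff_cancel)
  then show "two_sided_code (\<lambda>i. x (i + m)) j = two_sided_code x (j + zero_pos x m)"
    by (auto simp: two_sided_code_def zero_pos_shift image_iff)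
qed

text \<open>Starting just after a zero regroups the blocks \<open>0 1^a\<close> into blocks
  \<open>1^a 0\<close>. This carries the order results for one-sided codes over to tails of
  bi-infinite ones.\<close>

lemma two_sided_code_eq_unary_code:
  "two_sided_code x (zero_pos x n + 1 + int j) = unary_code (\<lambda>i. x (n + int i)) j"
proof (induction j arbitrary: n rule: less_induct)
  case (less j)
  show ?case
  proof (cases j "\<lambda>i. x (n + int i)" rule: unary_code_cases)
    case less
    then have "two_sided_code x (zero_pos x n + 1 + int j) = 1"
      by (intro two_sided_code_between[of x n]) (simp_all add: zero_pos_add_1)
    then show ?thesis using less by simp
  next
    case eq
    then have "zero_pos x n + 1 + int j = zero_pos x (n + 1)" by (simp add: zero_pos_add_1)
    then have "two_sided_code x (zero_pos x n + 1 + int j) = 0" by simp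
    then show ?thesis using eq by simp
  next
    case (tail k)
    then have "zero_pos x n + 1 + int j = zero_pos x (n + 1) + 1 + int k" by (simp add: zero_pos_add_1)
    then have "two_sided_code x (zero_pos x n + 1 + int j) = unary_code (\<lambda>i. x (n + 1 + int i)) k"
      using less.IH[of k "n + 1"] tail by (simp only: less_Suc_eq_le le_add2)
    then show ?thesis
      using tail unary_code_tail[of "\<lambda>i. x (n + int i)" k] by (simp add: add.assoc)
  qed
qed

lemma two_sided_code_suffix:
  assumes "zero_pos x n < i" "i \<le> zero_pos x (n + 1)"
  shows "(\<lambda>j. two_sided_code x (i + int j))
    = unary_code ((\<lambda>j. x (n + int j))(0 := nat (zero_pos x (n + 1) - i)))"
proof
  fix j
  define b where "b = (\<lambda>j. x (n + int j))(0 := nat (zero_pos x (n + 1) - i))"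
  have b0: "int (b 0) = zero_pos x (n + 1) - i" using assms by (simp add: b_def)
  have bS: "(\<lambda>i. b (Suc i)) = (\<lambda>i. x (n + 1 + int i))" by (simp add: b_def add_ac)
  show "two_sided_code x (i + int j) = unary_code b j"
  proof (cases j b rule: unary_code_cases)
    case less
    then show ?thesis using assms b0 by (simp add: two_sided_code_between[of x n])
  next
    case eq
    then have "i + int j = zero_pos x (n + 1)" using b0 by simp
    then show ?thesis using eq by simp
  next
    case (tail k)
    then have "i + int j = zero_pos x (n + 1) + 1 + int k" using b0 by simp
    then show ?thesis using tail by (simp only: unary_code_tail bS two_sided_code_eq_unary_code)
  qed
qed

text \<open>The next zero \<open>nz\<close> and the previous zero \<open>pz\<close> exist because
  zeros occur with bounded gaps, and \<open>nz\<close> undoes \<open>pz\<close> at zeros. Iterating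
  them from the zero at the origin enumerates the zeros as Z, and the digits are the numbers of ones
  between neighbours.\<close>

lemma two_sided_code_surj:
  assumes y0: "y 0 = 0" and le1: "\<And>i. y i \<le> 1"
    and zeros: "\<And>i. \<exists>k\<le>K. y (i + int k) = 0"
  shows "\<exists>x. y = two_sided_code x"
proof -
  define nz where "nz = (\<lambda>i. i + 1 + int (LEAST k. y (i + 1 + int k) = 0))"
  define pz where "pz = (\<lambda>i. i - 1 - int (LEAST k. y (i - 1 - int k) = 0))"
  have nz: "y (nz i) = 0" "i < nz i" for i
  proof -
    have "\<exists>k. y (i + 1 + int k) = 0" using zeros[of "i + 1"] by blast
    then show "y (nz i) = 0" unfolding nz_def by (rule LeastI_ex)
    show "i < nz i" by (simp add: nz_def)
  qed
  have nz_least: "y j \<noteq> 0" if "i < j" "j < nz i" for i j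
  proof
    assume "y j = 0"
    then have "y (i + 1 + int (nat (j - i - 1))) = 0" using that by simp
    then have "(LEAST k. y (i + 1 + int k) = 0) \<le> nat (j - i - 1)" by (rule Least_le)
    then show False using that by (simp add: nz_def)
  qed
  have pz: "y (pz i) = 0" "pz i < i" for i
  proof -
    \<comment> \<open>The window of K + 1 positions ending at i - 1 contains a zero, so there is one
      to the left of i.\<close>
    obtain k where k: "k \<le> K" "y (i - 1 - int K + int k) = 0" using zeros by blast
    then have "y (i - 1 - int (K - k)) = 0" by (simp add: of_nat_diff algebra_simps)
    then show "y (pz i) = 0" unfolding pz_def by (rule LeastI)
    show "pz i < i" by (simp add: pz_def)
  qed
  have pz_least: "y j \<noteq> 0" if "pz i < j" "j < i" for i j
  proof
    assume "y j = 0"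
    then have "y (i - 1 - int (nat (i - j - 1))) = 0" using that by simp
    then have "(LEAST k. y (i - 1 - int k) = 0) \<le> nat (i - j - 1)" by (rule Least_le)
    then show False using that by (simp add: pz_def)
  qed
  have nz_pz: "nz (pz i) = i" if "y i = 0" for i
    using nz[of "pz i"] pz[of i] nz_least[of "pz i" i] pz_least[of i "nz (pz i)"] that
    by (metis linorder_neqE)
  define Z where "Z = (\<lambda>n::int. if 0 \<le> n then (nz ^^ nat n) 0 else (pz ^^ nat (- n)) 0)"
  have yp: "y ((pz ^^ k) 0) = 0" for k by (cases k) (simp_all add: y0 pz)
  have Z: "Z (n + 1) = nz (Z n)" for n
  proof (cases "0 \<le> n")
    case True
    then have "nat (n + 1) = Suc (nat n)" by simp
    then show ?thesis using True by (simp add: Z_def)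
  next
    case False
    then have "nat (- n) = Suc (nat (- (n + 1)))" by simp
    then have "Z n = pz ((pz ^^ nat (- (n + 1))) 0)" using False by (simp add: Z_def)
    moreover have "Z (n + 1) = (pz ^^ nat (- (n + 1))) 0"
      using False by (cases "n = -1") (simp_all add: Z_def)
    ultimately show ?thesis using yp by (simp add: nz_pz)
  qed
  define x where "x = (\<lambda>n. nat (Z (n + 1) - Z n - 1))"
  have Zp: "Z n = zero_pos x n" for n
  proof (rule zero_pos_unique)
    show "Z 0 = 0" by (simp add: Z_def)
    show "Z (n + 1) = Z n + int (x n) + 1" for n using nz(2)[of "Z n"] by (simp add: x_def Z)
  qed
  have "y j = two_sided_code x j" for j
  proof -
    obtain n where n: "zero_pos x n < j" "j \<le> zero_pos x (n + 1)" using zero_pos_cover by blast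
    show ?thesis
    proof (cases "j = zero_pos x (n + 1)")
      case True
      then have "j = nz (Z n)" by (simp add: Z flip: Zp)
      then have "y j = 0" by (simp add: nz(1))
      then show ?thesis unfolding True by simp
    next
      case False
      then have "y j \<noteq> 0" using n nz_least[of "Z n" j] by (simp add: Z flip: Zp)
      then have "y j = 1" using le1[of j] by linarith
      then show ?thesis using n False by (simp add: two_sided_code_between)
    qed
  qed
  then show ?thesis by blast
qed

text \<open>A code always has a 0 at the origin. The shifts by m add the points whose origin lies
  elsewhere in a block.\<close>

definition coded_shift :: "(int \<Rightarrow> nat) set \<Rightarrow> (int \<Rightarrow> nat) set" where
  "coded_shift X = {\<lambda>j. two_sided_code x (j + m) | x m. x \<in> X}"

lemma lex_shift_shift: "x \<in> lex_shift d \<Longrightarrow> (\<lambda>i. x (i + m)) \<in> lex_shift d"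
  unfolding lex_shift_def mem_Collect_eq
proof
  fix i assume "\<forall>i. lex_le (\<lambda>j. x (i + int j)) d"
  then have "lex_le (\<lambda>j. x ((i + m) + int j)) d" by blast
  then show "lex_le (\<lambda>j. x (i + int j + m)) d" by (simp add: algebra_simps)
qed

lemma lex_shift_bounded: "x \<in> lex_shift d \<Longrightarrow> x i \<le> d 0"
  using lex_le_first[of "\<lambda>j. x (i + int j)" d] by (simp add: lex_shift_def)

lemma two_sided_code_in_lex_shift:
  assumes "x \<in> lex_shift d"
  shows "two_sided_code x \<in> lex_shift (unary_code d)"
  unfolding lex_shift_def
proof (intro CollectI allI)
  fix i
  obtain n where n: "zero_pos x n < i" "i \<le> zero_pos x (n + 1)" using zero_pos_cover by blast
  have "lex_le ((\<lambda>j. x (n + int j))(0 := nat (zero_pos x (n + 1) - i))) d"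
    using assms n by (intro lex_le_decrease_first) (auto simp: lex_shift_def zero_pos_add_1)
  then show "lex_le (\<lambda>j. two_sided_code x (i + int j)) (unary_code d)"
    unfolding two_sided_code_suffix[OF n] by (rule lex_le_unary_code_imp)
qed

theorem lex_shift_unary_code: "lex_shift (unary_code d) = coded_shift (lex_shift d)"
proof
  show "coded_shift (lex_shift d) \<subseteq> lex_shift (unary_code d)"
    using two_sided_code_in_lex_shift lex_shift_shift by (auto simp: coded_shift_def)
  show "lex_shift (unary_code d) \<subseteq> coded_shift (lex_shift d)"
  proof
    fix y assume y: "y \<in> lex_shift (unary_code d)"
    have le1: "y i \<le> 1" for i
      using lex_shift_bounded[OF y, of i] unary_code_le_1[of d 0] by linarith
    \<comment> \<open>The code of d starts with \<open>d 0\<close> ones and a 0. A run of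
      \<open>d 0 + 1\<close> ones would agree with these ones and then exceed the 0.\<close>
    have zeros: "\<exists>k\<le>d 0. y (i + int k) = 0" for i
    proof (rule ccontr)
      assume "\<not> ?thesis"
      then have one: "y (i + int k) = 1" if "k \<le> d 0" for k
        using that le1[of "i + int k"] by (metis le_less less_one)
      then have "\<forall>j<d 0. y (i + int j) = unary_code d j" by simp
      then have "y (i + int (d 0)) \<le> unary_code d (d 0)"
        using y by (simp only: lex_shift_def lex_le_def mem_Collect_eq)
      then show False using one by simp
    qed
    obtain m where m: "y m = 0" using zeros by blast
    define y' where "y' = (\<lambda>j. y (j + m))"
    have y': "y' \<in> lex_shift (unary_code d)" unfolding y'_def by (rule lex_shift_shift[OF y])
    have "\<exists>x. y' = two_sided_code x"
    proof (rule two_sided_code_surj)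
      show "\<exists>k\<le>d 0. y' (i + int k) = 0" for i
        using zeros[of "i + m"] by (simp add: y'_def add_ac)
    qed (use m le1 in \<open>simp_all add: y'_def\<close>)
    then obtain x where x: "y' = two_sided_code x" by blast
    have "lex_le (\<lambda>j. x (n + int j)) d" for n
    proof -
      have "lex_le (\<lambda>j. two_sided_code x (zero_pos x n + 1 + int j)) (unary_code d)"
        using y' by (simp add: lex_shift_def x)
      then show ?thesis by (simp only: two_sided_code_eq_unary_code lex_le_unary_code_iff)
    qed
    then have "x \<in> lex_shift d" by (simp add: lex_shift_def)
    moreover have "y = (\<lambda>j. two_sided_code x (j + (- m)))"
      by (simp add: x[symmetric] y'_def)
    ultimately show "y \<in> coded_shift (lex_shift d)" unfolding coded_shift_def by blast
  qed
qed

section \<open>Flow equivalence\<close>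

text \<open>The sets of sequences agreeing with x in this sense form a neighbourhood base at x, so
  continuity becomes a count of coordinates.\<close>

definition agree :: "int \<Rightarrow> (int \<Rightarrow> nat) \<Rightarrow> (int \<Rightarrow> nat) \<Rightarrow> bool" where
  "agree N x y \<longleftrightarrow> (\<forall>i. \<bar>i\<bar> \<le> N \<longrightarrow> x i = y i)"

lemma agree_mono: "agree N x y \<Longrightarrow> M \<le> N \<Longrightarrow> agree M x y"
  by (auto simp: agree_def)

lemma abs_le_abs_zero_pos: "\<bar>n\<bar> \<le> \<bar>zero_pos x n\<bar>"
  using zero_pos_gap[of 0 n x] zero_pos_gap[of n 0 x] by (cases "0 \<le> n") auto

lemma abs_zero_pos_le:
  assumes "\<And>i. x i \<le> K"
  shows "\<bar>zero_pos x n\<bar> \<le> (int K + 1) * \<bar>n\<bar>"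
proof (cases "0 \<le> n")
  case True
  then show ?thesis using zero_pos_gap_le[OF assms True] zero_pos_gap[OF True, of x] by simp
next
  case False
  then have "n \<le> 0" by simp
  then show ?thesis using zero_pos_gap_le[OF assms \<open>n \<le> 0\<close>] zero_pos_gap[OF \<open>n \<le> 0\<close>, of x] by simp
qed

text \<open>The bound N + 1 is asymmetric because for n > 0 only the digits at 0 to n - 1 enter the
  sum, while for n < 0 those at n to -1 do.\<close>

lemma zero_pos_agree:
  assumes "agree N x y" "- N \<le> n" "n \<le> N + 1"
  shows "zero_pos x n = zero_pos y n"
proof -
  have "(\<Sum>i\<in>{0..<n}. int (x i) + 1) = (\<Sum>i\<in>{0..<n}. int (y i) + 1)"
    "(\<Sum>i\<in>{n..<0}. int (x i) + 1) = (\<Sum>i\<in>{n..<0}. int (y i) + 1)"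
    using assms by (auto simp: agree_def intro!: sum.cong)
  then show ?thesis by (simp add: zero_pos_def)
qed

lemma agree_two_sided_code:
  assumes "agree N x y"
  shows "agree N (two_sided_code x) (two_sided_code y)"
  unfolding agree_def
proof (intro allI impI)
  fix j :: int assume j: "\<bar>j\<bar> \<le> N"
  have "zero_pos x n = j \<longleftrightarrow> zero_pos y n = j" for n
  proof (cases "\<bar>n\<bar> \<le> N")
    case True
    then show ?thesis using zero_pos_agree[OF assms, of n] by simp
  next
    case False
    then show ?thesis
      using j abs_le_abs_zero_pos[of n x] abs_le_abs_zero_pos[of n y] by auto
  qed
  then have "j \<in> range (zero_pos x) \<longleftrightarrow> j \<in> range (zero_pos y)" by (metis rangeE rangeI)
  then show "two_sided_code x j = two_sided_code y j" by (simp add: two_sided_code_def)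
qed

text \<open>A larger \<open>y n\<close> would put the next zero of x strictly inside a run of ones
  of the code of y. Used in both directions, this gives equal digits.\<close>

lemma next_zero_not_less:
  assumes "zero_pos x n = zero_pos y n"
    and "two_sided_code y (zero_pos x (n + 1)) = 0"
  shows "y n \<le> x n"
proof (rule ccontr)
  assume "\<not> y n \<le> x n"
  then have "two_sided_code y (zero_pos x (n + 1)) = 1"
    using assms(1) by (intro two_sided_code_between[of y n]) (simp_all add: zero_pos_add_1)
  then show False using assms(2) by simp
qed

lemma previous_zero_not_less:
  assumes "zero_pos x (n + 1) = zero_pos y (n + 1)"
    and "two_sided_code y (zero_pos x n) = 0"
  shows "y n \<le> x n"
proof (rule ccontr)
  assume "\<not> y n \<le> x n"
  then have "two_sided_code y (zero_pos x n) = 1"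
    using assms(1) by (intro two_sided_code_between[of y n]) (simp_all add: zero_pos_add_1)
  then show False using assms(2) by simp
qed

text \<open>Decoding is continuous for bounded digits. Zeros with index up to N + 1 in absolute
  value lie within \<open>(int K + 1) * (N + 1)\<close> of the origin, where the codes agree, so
  they can be matched one by one outwards from the common zero at 0. The extra 1 is needed since the
  digit at N ends at the zero with index N + 1.\<close>

lemma agree_two_sided_codeD:
  assumes x: "\<And>i. x i \<le> K" and y: "\<And>i. y i \<le> K"
    and agr: "agree ((int K + 1) * (N + 1)) (two_sided_code x) (two_sided_code y)"
  shows "agree N x y"
proof -
  have bnd: "(int K + 1) * \<bar>n\<bar> \<le> (int K + 1) * (N + 1)" if "\<bar>n\<bar> \<le> N + 1" for n
    using that by (intro mult_left_mono) auto
  have zx: "two_sided_code y (zero_pos x n) = 0" if "\<bar>n\<bar> \<le> N + 1" for n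
  proof -
    have "\<bar>zero_pos x n\<bar> \<le> (int K + 1) * (N + 1)"
      using bnd[OF that] abs_zero_pos_le[of x K n, OF x] by (rule order_trans[rotated])
    then have "two_sided_code x (zero_pos x n) = two_sided_code y (zero_pos x n)"
      using agr unfolding agree_def by blast
    then show ?thesis by simp
  qed
  have zy: "two_sided_code x (zero_pos y n) = 0" if "\<bar>n\<bar> \<le> N + 1" for n
  proof -
    have "\<bar>zero_pos y n\<bar> \<le> (int K + 1) * (N + 1)"
      using bnd[OF that] abs_zero_pos_le[of y K n, OF y] by (rule order_trans[rotated])
    then have "two_sided_code x (zero_pos y n) = two_sided_code y (zero_pos y n)"
      using agr unfolding agree_def by blast
    then show ?thesis by simp
  qed
  have up: "int k \<le> N + 1 \<Longrightarrow> zero_pos x (int k) = zero_pos y (int k)" for k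
  proof (induction k)
    case (Suc k)
    define n where "n = int k"
    have e: "zero_pos x n = zero_pos y n" unfolding n_def using Suc by simp
    have n: "\<bar>n + 1\<bar> \<le> N + 1" using Suc.prems by (simp add: n_def)
    have "x n = y n"
      using next_zero_not_less[OF e[symmetric] zy[OF n]] next_zero_not_less[OF e zx[OF n]]
      by (rule antisym)
    then have "zero_pos x (n + 1) = zero_pos y (n + 1)" using e by (simp add: zero_pos_add_1)
    moreover have "int (Suc k) = n + 1" by (simp add: n_def)
    ultimately show ?case by (simp only:)
  qed simp
  have down: "int k \<le> N + 1 \<Longrightarrow> zero_pos x (- int k) = zero_pos y (- int k)" for k
  proof (induction k)
    case (Suc k)
    define n where "n = - int (Suc k)"
    have n: "n + 1 = - int k" by (simp add: n_def)
    have e: "zero_pos x (n + 1) = zero_pos y (n + 1)" unfolding n using Suc by simp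
    have l: "\<bar>n\<bar> \<le> N + 1" using Suc.prems by (simp add: n_def)
    have "x n = y n"
      using previous_zero_not_less[OF e[symmetric] zy[OF l]] previous_zero_not_less[OF e zx[OF l]]
      by (rule antisym)
    then show ?case using e unfolding n_def[symmetric] by (simp add: zero_pos_add_1)
  qed simp
  have zp: "zero_pos x n = zero_pos y n" if "\<bar>n\<bar> \<le> N + 1" for n
    using up[of "nat n"] down[of "nat (- n)"] that by (cases "0 \<le> n") auto
  show ?thesis unfolding agree_def
  proof (intro allI impI)
    fix i assume "\<bar>i\<bar> \<le> N"
    then show "x i = y i"
      using zp[of i] zp[of "i + 1"] by (simp add: zero_pos_add_1)
  qed
qed

lemma two_sided_code_inj:
  assumes x: "\<And>i. x i \<le> K" and y: "\<And>i. y i \<le> K"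
    and "two_sided_code x = two_sided_code y"
  shows "x = y"
proof
  fix i
  have "agree \<bar>i\<bar> x y" by (rule agree_two_sided_codeD[OF x y]) (simp add: assms(3) agree_def)
  then show "x i = y i" by (simp add: agree_def)
qed

section \<open>The change of time\<close>

definition time_change :: "(int \<Rightarrow> nat) \<Rightarrow> real \<Rightarrow> real" where
  "time_change x t = of_int (zero_pos x \<lfloor>t\<rfloor>) + frac t * (real (x \<lfloor>t\<rfloor>) + 1)"

text \<open>\<open>time_change x\<close> interpolates \<open>zero_pos x\<close> linearly, with slope
  \<open>x n + 1\<close> on [n, n + 1). All slopes are at least 1, and at most K + 1 if K bounds the
  digits.\<close>

lemma time_change_bounds:
  assumes "s \<le> t"
  shows "t - s \<le> time_change x t - time_change x s"
    and "(\<And>i. x i \<le> K) \<Longrightarrow> time_change x t - time_change x s \<le> (real K + 1) * (t - s)"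
proof -
  have "t - s \<le> time_change x t - time_change x s \<and>
    ((\<forall>i. x i \<le> K) \<longrightarrow> time_change x t - time_change x s \<le> (real K + 1) * (t - s))"
  proof (cases "\<lfloor>s\<rfloor> = \<lfloor>t\<rfloor>")
    case True
    then have e: "time_change x t - time_change x s = (t - s) * (real (x \<lfloor>t\<rfloor>) + 1)"
      by (simp add: time_change_def frac_def algebra_simps)
    have "(t - s) * 1 \<le> (t - s) * (real (x \<lfloor>t\<rfloor>) + 1)"
      using assms by (intro mult_left_mono) auto
    moreover have "(t - s) * (real (x \<lfloor>t\<rfloor>) + 1) \<le> (t - s) * (real K + 1)" if "\<forall>i. x i \<le> K"
      using assms that by (intro mult_left_mono) auto
    ultimately show ?thesis unfolding e by (simp add: mult.commute)
  next
    case False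
    define n m where "n = \<lfloor>s\<rfloor>" and "m = \<lfloor>t\<rfloor>"
    have nm: "n + 1 \<le> m" using False floor_mono[OF assms] by (simp add: n_def m_def)
    \<comment> \<open>The interval from s to t splits into the rest f of its first unit, m - (n + 1)
      whole units and the initial part g of its last unit.\<close>
    define f g where "f = 1 - frac s" and "g = frac t"
    have f: "0 \<le> f" and g: "0 \<le> g" by (simp_all add: f_def g_def frac_lt_1 less_imp_le)
    have ts: "t - s = of_int (m - (n + 1)) + f + g"
      by (simp add: f_def g_def n_def m_def frac_def)
    have e: "time_change x t - time_change x s
        = of_int (zero_pos x m - zero_pos x (n + 1)) + f * (real (x n) + 1) + g * (real (x m) + 1)"
      unfolding time_change_def m_def[symmetric] n_def[symmetric] g_def[symmetric] zero_pos_add_1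
      by (simp add: f_def algebra_simps)
    have "f * 1 \<le> f * (real (x n) + 1)" "g * 1 \<le> g * (real (x m) + 1)"
      using f g by (intro mult_left_mono; simp)+
    moreover have "real_of_int (m - (n + 1)) \<le> of_int (zero_pos x m - zero_pos x (n + 1))"
      using zero_pos_gap[OF nm, of x] by linarith
    ultimately have 1: "t - s \<le> time_change x t - time_change x s" unfolding ts e by linarith
    have "time_change x t - time_change x s \<le> (real K + 1) * (t - s)" if K: "\<forall>i. x i \<le> K"
    proof -
      have "f * (real (x n) + 1) \<le> f * (real K + 1)" "g * (real (x m) + 1) \<le> g * (real K + 1)"
        using f g K by (intro mult_left_mono; simp)+
      moreover have "real_of_int (zero_pos x m - zero_pos x (n + 1)) \<le> of_int ((int K + 1) * (m - (n + 1)))"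
        using zero_pos_gap_le[of x K "n + 1" m] nm K by (subst of_int_le_iff) auto
      moreover have "real_of_int ((int K + 1) * (m - (n + 1))) = (real K + 1) * of_int (m - (n + 1))"
        by simp
      moreover have "(real K + 1) * (t - s)
          = (real K + 1) * of_int (m - (n + 1)) + f * (real K + 1) + g * (real K + 1)"
        unfolding ts by (simp add: algebra_simps)
      ultimately show ?thesis unfolding e by linarith
    qed
    then show ?thesis using 1 by blast
  qed
  then show "t - s \<le> time_change x t - time_change x s"
    and "(\<And>i. x i \<le> K) \<Longrightarrow> time_change x t - time_change x s \<le> (real K + 1) * (t - s)"
    by auto
qed

lemma abs_time_change_diff_ge: "\<bar>t - s\<bar> \<le> \<bar>time_change x t - time_change x s\<bar>"
  using time_change_bounds(1)[of s t x] time_change_bounds(1)[of t s x] by linarith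

lemma abs_time_change_diff_le:
  assumes "\<And>i. x i \<le> K"
  shows "\<bar>time_change x t - time_change x s\<bar> \<le> (real K + 1) * \<bar>t - s\<bar>"
proof (cases "s \<le> t")
  case True
  then show ?thesis using time_change_bounds[OF True, of x] assms by fastforce
next
  case False
  then have "t \<le> s" by simp
  then show ?thesis using time_change_bounds[OF \<open>t \<le> s\<close>, of x] assms by fastforce
qed

lemma mono_time_change: "mono (time_change x)"
  using time_change_bounds(1)[of _ _ x] by (fastforce intro: monoI)

lemma inj_time_change: "time_change x s = time_change x t \<Longrightarrow> s = t"
  using abs_time_change_diff_ge[of t s x] by simp

lemma surj_time_change: "\<exists>t. time_change x t = u"
proof -
  \<comment> \<open>Covering \<open>\<lfloor>u\<rfloor> + 1\<close> instead of
    \<open>\<lfloor>u\<rfloor>\<close> turns the right-closed interval into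
    \<open>zero_pos x n\<close> \<le> u < \<open>zero_pos x (n + 1)\<close>.\<close>
  obtain n where n: "zero_pos x n < \<lfloor>u\<rfloor> + 1" "\<lfloor>u\<rfloor> + 1 \<le> zero_pos x (n + 1)"
    using zero_pos_cover by blast
  define f where "f = (u - of_int (zero_pos x n)) / (real (x n) + 1)"
  have "real_of_int (zero_pos x n) \<le> u" using n(1) by linarith
  then have f0: "0 \<le> f" by (simp add: f_def)
  have "u < of_int (zero_pos x (n + 1))" using n(2) by linarith
  then have f1: "f < 1" by (simp add: f_def zero_pos_add_1)
  have "\<lfloor>of_int n + f\<rfloor> = n" using f0 f1 by (simp add: floor_eq_iff)
  then have "time_change x (of_int n + f) = u"
    by (simp add: time_change_def frac_def) (simp add: f_def)
  then show ?thesis by blast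
qed

lemma time_change_shift:
  "time_change (\<lambda>i. x (i + m)) t = time_change x (t + of_int m) - of_int (zero_pos x m)"
  by (simp add: time_change_def zero_pos_shift frac_def)

text \<open>Sequences that agree on a large window have the same time change there, so continuity in
  the pair (x, t) reduces to continuity in t.\<close>

lemma time_change_agree:
  assumes "agree N x y" "\<bar>t\<bar> \<le> of_int N"
  shows "time_change x t = time_change y t"
proof -
  have "\<bar>\<lfloor>t\<rfloor>\<bar> \<le> N" using assms(2) by linarith
  then show ?thesis
    using assms(1) zero_pos_agree[OF assms(1), of "\<lfloor>t\<rfloor>"] by (simp add: time_change_def agree_def)
qed

section \<open>Open sets of the suspension\<close>

lemma openin_shift_top_cylinder: "openin (shift_top X) {y \<in> X. agree N y x}"
proof -
  have "openin (product_topology (\<lambda>_. discrete_topology UNIV) UNIV) {y. agree N y x}"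
    unfolding openin_product_topology_alt
  proof
    fix y assume y: "y \<in> {y. agree N y x}"
    define U where "U = (\<lambda>i. if \<bar>i\<bar> \<le> N then {x i} else UNIV)"
    have "finite {i \<in> UNIV. U i \<noteq> topspace (discrete_topology UNIV)}"
      by (rule finite_subset[of _ "{-N..N}"]) (auto simp: U_def split: if_splits)
    moreover have "y \<in> Pi\<^sub>E UNIV U" using y by (auto simp: U_def agree_def)
    moreover have "Pi\<^sub>E UNIV U \<subseteq> {y. agree N y x}"
      by (auto simp: U_def agree_def PiE_iff split: if_splits)
    ultimately show "\<exists>U. finite {i \<in> UNIV. U i \<noteq> topspace (discrete_topology UNIV)} \<and>
       (\<forall>i\<in>UNIV. openin (discrete_topology UNIV) (U i)) \<and> y \<in> Pi\<^sub>E UNIV U \<and>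
       Pi\<^sub>E UNIV U \<subseteq> {y. agree N y x}" by (intro exI[of _ U]) auto
  qed
  then show ?thesis
    unfolding shift_top_def openin_subtopology by (auto intro!: exI[of _ "{y. agree N y x}"])
qed

lemma openin_shift_topD:
  assumes "openin (shift_top X) U" "x \<in> U"
  shows "\<exists>N. \<forall>y\<in>X. agree N y x \<longrightarrow> y \<in> U"
proof -
  obtain T where T: "openin (product_topology (\<lambda>_. discrete_topology UNIV) UNIV) T" "U = T \<inter> X"
    using assms(1) unfolding shift_top_def openin_subtopology by blast
  then obtain V :: "int \<Rightarrow> nat set" where V: "finite {i. V i \<noteq> UNIV}" "x \<in> Pi\<^sub>E UNIV V" "Pi\<^sub>E UNIV V \<subseteq> T"
    using assms(2) unfolding openin_product_topology_alt by fastforce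
  obtain N where N: "\<And>i. V i \<noteq> UNIV \<Longrightarrow> \<bar>i\<bar> \<le> N"
    using V(1) bdd_above_finite[of "abs ` {i. V i \<noteq> UNIV}"] by (auto simp: bdd_above_def)
  have "y \<in> U" if "y \<in> X" "agree N y x" for y
  proof -
    have "y i \<in> V i" for i
      using N[of i] V(2) that(2) by (cases "V i = UNIV") (auto simp: agree_def PiE_iff)
    then show ?thesis using V(3) T(2) that(1) by (auto simp: PiE_iff)
  qed
  then show ?thesis by blast
qed

lemma openin_shift_top_times_real:
  "openin (prod_topology (shift_top X) euclideanreal) W \<longleftrightarrow> W \<subseteq> X \<times> UNIV \<and>
    (\<forall>x t. (x, t) \<in> W \<longrightarrow>
      (\<exists>N. \<exists>e>0. \<forall>y\<in>X. \<forall>s. agree N y x \<longrightarrow> \<bar>s - t\<bar> < e \<longrightarrow> (y, s) \<in> W))"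
  (is "?L \<longleftrightarrow> ?R")
proof
  assume L: ?L
  show ?R
  proof (intro conjI allI impI)
    show "W \<subseteq> X \<times> UNIV" using openin_subset[OF L] by (simp add: shift_top_def)
    fix x t assume "(x, t) \<in> W"
    then obtain U V where UV: "openin (shift_top X) U" "openin euclideanreal V" "x \<in> U" "t \<in> V" "U \<times> V \<subseteq> W"
      using L[unfolded openin_prod_topology_alt, rule_format] by meson
    obtain N where N: "\<forall>y\<in>X. agree N y x \<longrightarrow> y \<in> U" using openin_shift_topD UV(1,3) by blast
    obtain e where e: "e > 0" "\<forall>s. dist s t < e \<longrightarrow> s \<in> V"
      using UV(2,4) unfolding open_openin[symmetric] open_dist by blast
    show "\<exists>N. \<exists>e>0. \<forall>y\<in>X. \<forall>s. agree N y x \<longrightarrow> \<bar>s - t\<bar> < e \<longrightarrow> (y, s) \<in> W"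
      using N e UV(5) by (intro exI[of _ N] exI[of _ e]) (auto simp: dist_real_def)
  qed
next
  assume R: ?R
  show ?L
    unfolding openin_prod_topology_alt
  proof (intro allI impI)
    fix x t assume xt: "(x, t) \<in> W"
    then obtain N e where Ne: "e > 0" "\<forall>y\<in>X. \<forall>s. agree N y x \<longrightarrow> \<bar>s - t\<bar> < e \<longrightarrow> (y, s) \<in> W"
      using R by blast
    have "x \<in> X" using xt R by blast
    then have "openin (shift_top X) {y \<in> X. agree N y x} \<and> openin euclideanreal (ball t e) \<and>
      x \<in> {y \<in> X. agree N y x} \<and> t \<in> ball t e \<and> {y \<in> X. agree N y x} \<times> ball t e \<subseteq> W"
      using Ne openin_shift_top_cylinder by (auto simp: agree_def dist_real_def abs_minus_commute)
    then show "\<exists>U V. openin (shift_top X) U \<and> openin euclideanreal V \<and> x \<in> U \<and> t \<in> V \<and> U \<times> V \<subseteq> W"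
      by blast
  qed
qed

text \<open>\<open>susp_top\<close> is built with \<open>topology\<close>, whose open sets are the
  intended ones only once the predicate is known to be a topology. It is one because preimages
  commute with intersections and unions.\<close>

lemma openin_susp_top_preimage:
  "openin (susp_top X) U \<longleftrightarrow> U \<subseteq> susp_space X \<and>
     openin (prod_topology (shift_top X) euclideanreal)
       {p \<in> X \<times> UNIV. susp_class (fst p) (snd p) \<in> U}"
proof -
  let ?P = "prod_topology (shift_top X) euclideanreal"
  let ?pre = "\<lambda>U. {p \<in> X \<times> UNIV. susp_class (fst p) (snd p) \<in> U}"
  have "istopology (\<lambda>U. U \<subseteq> susp_space X \<and> openin ?P (?pre U))"
    unfolding istopology_def
  proof (intro conjI allI impI)
    fix S T assume "S \<subseteq> susp_space X \<and> openin ?P (?pre S)" "T \<subseteq> susp_space X \<and> openin ?P (?pre T)"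
    moreover have "?pre (S \<inter> T) = ?pre S \<inter> ?pre T" by auto
    ultimately show "openin ?P (?pre (S \<inter> T))" by (simp only: openin_Int)
    show "S \<inter> T \<subseteq> susp_space X" using \<open>S \<subseteq> susp_space X \<and> openin ?P (?pre S)\<close> by auto
  next
    fix \<K> assume K: "\<forall>U\<in>\<K>. U \<subseteq> susp_space X \<and> openin ?P (?pre U)"
    then show "\<Union> \<K> \<subseteq> susp_space X" by auto
    have "?pre (\<Union> \<K>) = \<Union> (?pre ` \<K>)" by auto
    moreover have "openin ?P (\<Union> (?pre ` \<K>))" using K by (intro openin_Union) blast
    ultimately show "openin ?P (?pre (\<Union> \<K>))" by simp
  qed
  then show ?thesis unfolding susp_top_def by (simp add: topology_inverse')
qed

lemma openin_susp_top:
  "openin (susp_top X) U \<longleftrightarrow> U \<subseteq> susp_space X \<and>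
    (\<forall>x\<in>X. \<forall>t. susp_class x t \<in> U \<longrightarrow>
      (\<exists>N. \<exists>e>0. \<forall>y\<in>X. \<forall>s. agree N y x \<longrightarrow> \<bar>s - t\<bar> < e \<longrightarrow> susp_class y s \<in> U))"
proof -
  have *: "(x, t) \<in> {p \<in> X \<times> UNIV. susp_class (fst p) (snd p) \<in> U}
      \<longleftrightarrow> x \<in> X \<and> susp_class x t \<in> U" for x t by simp
  have **: "{p \<in> X \<times> UNIV. susp_class (fst p) (snd p) \<in> U} \<subseteq> X \<times> UNIV" by blast
  show ?thesis
    unfolding openin_susp_top_preimage openin_shift_top_times_real *
    by (simp add: ** Ball_def imp_conjL cong: imp_cong)
qed

lemma topspace_susp_top [simp]: "topspace (susp_top X) = susp_space X"
proof -
  have "openin (susp_top X) (susp_space X)"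
    unfolding openin_susp_top by (auto simp: susp_space_def intro: zero_less_one)
  moreover have "topspace (susp_top X) \<subseteq> susp_space X"
    using openin_topspace[of "susp_top X"] unfolding openin_susp_top by blast
  ultimately show ?thesis using openin_subset by blast
qed

lemma susp_class_self: "(x, t) \<in> susp_class x t"
  unfolding susp_class_def by (auto intro!: exI[of _ 0])

lemma susp_class_shift: "susp_class (\<lambda>i. x (i + n)) (t - of_int n) = susp_class x t"
proof -
  have sub: "susp_class (\<lambda>i. x (i + n)) (t - of_int n) \<subseteq> susp_class x t" for x t n
  proof
    fix p assume "p \<in> susp_class (\<lambda>i. x (i + n)) (t - of_int n)"
    then obtain m where "p = ((\<lambda>i. x (i + m + n)), t - of_int n - of_int m)"
      unfolding susp_class_def by blast
    then have "p = ((\<lambda>i. x (i + (m + n))), t - of_int (m + n))" by (simp add: add.assoc)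
    then show "p \<in> susp_class x t" unfolding susp_class_def by blast
  qed
  show ?thesis
    using sub[of x n t] sub[of "\<lambda>i. x (i + n)" "- n" "t - of_int n"] by simp
qed

lemma susp_class_eq_iff:
  "susp_class x t = susp_class y s \<longleftrightarrow> (\<exists>n. y = (\<lambda>i. x (i + n)) \<and> s = t - of_int n)" (is "?L \<longleftrightarrow> ?R")
proof
  assume ?L
  then have "(y, s) \<in> susp_class x t" using susp_class_self by simp
  then show ?R unfolding susp_class_def by auto
qed (auto simp: susp_class_shift)

lemma susp_add_susp_class: "susp_add (susp_class x t) r = susp_class x (t + r)"
proof (intro set_eqI iffI)
  fix p assume "p \<in> susp_add (susp_class x t) r"
  then obtain n where "p = ((\<lambda>i. x (i + n)), t - of_int n + r)"
    unfolding susp_add_def susp_class_def by blast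
  then have "p = ((\<lambda>i. x (i + n)), t + r - of_int n)" by simp
  then show "p \<in> susp_class x (t + r)" unfolding susp_class_def by blast
next
  fix p assume "p \<in> susp_class x (t + r)"
  then obtain n where "p = ((\<lambda>i. x (i + n)), t + r - of_int n)"
    unfolding susp_class_def by blast
  then have "p = ((\<lambda>i. x (i + n)), t - of_int n + r)" by simp
  then show "p \<in> susp_add (susp_class x t) r" unfolding susp_add_def susp_class_def by blast
qed

section \<open>The map between the suspensions\<close>

definition susp_code :: "((int \<Rightarrow> nat) \<times> real) set \<Rightarrow> ((int \<Rightarrow> nat) \<times> real) set" where
  "susp_code z = (let p = SOME p. p \<in> z
     in susp_class (two_sided_code (fst p)) (time_change (fst p) (snd p)))"

text \<open>The choice of representative is harmless: shifting x by n shifts its code by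
  \<open>zero_pos x n\<close> and lowers the changed time by the same amount.\<close>

lemma susp_code_susp_class:
  "susp_code (susp_class x t) = susp_class (two_sided_code x) (time_change x t)"
proof -
  define p where "p = (SOME p. p \<in> susp_class x t)"
  have "p \<in> susp_class x t" unfolding p_def using susp_class_self by (rule someI)
  then obtain n where n: "p = ((\<lambda>i. x (i + n)), t - of_int n)" unfolding susp_class_def by blast
  show ?thesis
    unfolding susp_code_def p_def[symmetric] Let_def
    by (simp add: n two_sided_code_shift time_change_shift susp_class_shift)
qed

lemma coded_shift_zero:
  assumes inv: "\<And>x m. x \<in> X \<Longrightarrow> (\<lambda>i. x (i + m)) \<in> X" and y: "y \<in> coded_shift X" "y 0 = 0"
  shows "\<exists>x\<in>X. y = two_sided_code x"
proof -
  obtain x m where x: "x \<in> X" "y = (\<lambda>j. two_sided_code x (j + m))"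
    using y(1) unfolding coded_shift_def by blast
  then obtain n where "m = zero_pos x n" using y(2) by (auto simp: two_sided_code_eq_0_iff)
  then have "y = two_sided_code (\<lambda>i. x (i + n))" using x(2) by (simp add: two_sided_code_shift)
  then show ?thesis using inv[OF x(1)] by blast
qed

lemma coded_shift_shift: "y \<in> coded_shift X \<Longrightarrow> (\<lambda>i. y (i + m)) \<in> coded_shift X"
  unfolding coded_shift_def by (force simp: add.assoc)

lemma two_sided_code_in_coded_shift: "x \<in> X \<Longrightarrow> two_sided_code x \<in> coded_shift X"
  unfolding coded_shift_def by (auto intro!: exI[of _ x] exI[of _ 0])

text \<open>\<open>susp_code\<close> is a bijection that carries each orbit to an orbit through the
  increasing \<open>time_change\<close>. It is open since decoding is continuous and
  \<open>time_change\<close> does not contract distances; it is continuous since coding is and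
  \<open>time_change\<close> is Lipschitz.\<close>

theorem flow_equivalent_coded_shift:
  assumes inv: "\<And>x m. x \<in> X \<Longrightarrow> (\<lambda>i. x (i + m)) \<in> X"
    and bounded: "\<And>x i. x \<in> X \<Longrightarrow> x i \<le> K"
  shows "flow_equivalent X (coded_shift X)"
proof -
  let ?Y = "coded_shift X"
  have inj: "inj_on susp_code (susp_space X)"
  proof (rule inj_onI)
    fix z w assume "z \<in> susp_space X" "w \<in> susp_space X" and eq: "susp_code z = susp_code w"
    then obtain x t y s where z: "z = susp_class x t" "x \<in> X" and w: "w = susp_class y s" "y \<in> X"
      unfolding susp_space_def by blast
    obtain n where n: "two_sided_code y = (\<lambda>i. two_sided_code x (i + n))"
        "time_change y s = time_change x t - of_int n"
      using eq unfolding z w susp_code_susp_class susp_class_eq_iff by blast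
    \<comment> \<open>The code of y has a 0 at the origin, so the shift n leads to a zero of the
      code of x. Hence n comes from a shift of x by m digits, and decoding applies.\<close>
    have "two_sided_code x n = 0" using fun_cong[OF n(1), of 0] by simp
    then obtain m where m: "n = zero_pos x m" by (auto simp: two_sided_code_eq_0_iff)
    have "two_sided_code y = two_sided_code (\<lambda>i. x (i + m))"
      unfolding n(1) m by (rule two_sided_code_shift[symmetric])
    then have y: "y = (\<lambda>i. x (i + m))"
      using bounded w(2) z(2) by (intro two_sided_code_inj[of y K]) auto
    have "time_change x (s + of_int m) = time_change x t"
      using n(2) unfolding y m time_change_shift by simp
    then have "s = t - of_int m" using inj_time_change by fastforce
    then show "z = w" unfolding z w y by (simp add: susp_class_shift)
  qed
  \<comment> \<open>Moving a zero of y to the origin gives a representative of the class of (y, u)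
    that is a code with a changed time.\<close>
  have rep: "\<exists>x t. x \<in> X \<and> (\<lambda>j. y (j - m)) = two_sided_code x \<and> u + of_int m = time_change x t"
    if y: "y \<in> ?Y" and y0: "y (- m) = 0" for y u m
  proof -
    have "(\<lambda>j. y (j - m)) \<in> ?Y" using coded_shift_shift[OF y, of "- m"] by simp
    then obtain x where "x \<in> X" "(\<lambda>j. y (j - m)) = two_sided_code x"
      using coded_shift_zero[of X "\<lambda>j. y (j - m)", OF inv] y0 by auto
    moreover obtain t where "time_change x t = u + of_int m" using surj_time_change by blast
    ultimately show ?thesis by metis
  qed
  have classY: "susp_class (\<lambda>j. y (j - m)) (u + of_int m) = susp_class y u" for y u m
    using susp_class_shift[of y "- m" u] by (simp only: of_int_minus diff_minus_eq_add add_uminus_conv_diff)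
  have zeroY: "\<exists>m. y (- m) = 0" if "y \<in> ?Y" for y
  proof -
    obtain x m where "y = (\<lambda>j. two_sided_code x (j + m))" using \<open>y \<in> ?Y\<close> unfolding coded_shift_def by blast
    then show ?thesis by (intro exI[of _ m]) simp
  qed
  have image: "susp_code ` susp_space X = susp_space ?Y"
  proof
    show "susp_code ` susp_space X \<subseteq> susp_space ?Y"
    proof
      fix w assume "w \<in> susp_code ` susp_space X"
      then obtain x t where "x \<in> X" "w = susp_code (susp_class x t)" unfolding susp_space_def by blast
      then show "w \<in> susp_space ?Y"
        unfolding susp_code_susp_class susp_space_def using two_sided_code_in_coded_shift by blast
    qed
    show "susp_space ?Y \<subseteq> susp_code ` susp_space X"
    proof
      fix w assume "w \<in> susp_space ?Y"
      then obtain y u where w: "w = susp_class y u" "y \<in> ?Y" unfolding susp_space_def by blast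
      obtain m where "y (- m) = 0" using zeroY[OF w(2)] by blast
      then obtain x t where x: "x \<in> X" "(\<lambda>j. y (j - m)) = two_sided_code x" "u + of_int m = time_change x t"
        using rep[OF w(2)] by blast
      have "w = susp_code (susp_class x t)"
        using classY[of y m u] unfolding w(1) susp_code_susp_class x(2,3) by simp
      then show "w \<in> susp_code ` susp_space X" using x(1) unfolding susp_space_def by blast
    qed
  qed
  have mem: "susp_class (two_sided_code x) (time_change x t) \<in> susp_code ` V \<longleftrightarrow> susp_class x t \<in> V"
    if "x \<in> X" "V \<subseteq> susp_space X" for x t V
  proof -
    have "susp_class x t \<in> susp_space X" using that(1) unfolding susp_space_def by blast
    then show ?thesis
      unfolding susp_code_susp_class[symmetric] using inj_on_image_mem_iff[OF inj _ that(2)] by blast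
  qed
  have open_image: "openin (susp_top ?Y) (susp_code ` V)" if V: "openin (susp_top X) V" for V
    unfolding openin_susp_top
  proof (intro conjI ballI allI impI)
    have VX: "V \<subseteq> susp_space X" using V by (simp add: openin_susp_top)
    then show "susp_code ` V \<subseteq> susp_space ?Y" using image by blast
    fix y u assume y: "y \<in> ?Y" and yu: "susp_class y u \<in> susp_code ` V"
    obtain m where m: "y (- m) = 0" using zeroY[OF y] by blast
    then obtain x t where x: "x \<in> X" "(\<lambda>j. y (j - m)) = two_sided_code x" "u + of_int m = time_change x t"
      using rep[OF y] by blast
    have "susp_class (two_sided_code x) (time_change x t) \<in> susp_code ` V"
      using yu classY[of y m u] unfolding x(2,3) by simp
    then have "susp_class x t \<in> V" using mem[OF x(1) VX] by blast
    then obtain N e where Ne: "e > 0"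
      "\<And>x' t'. x' \<in> X \<Longrightarrow> agree N x' x \<Longrightarrow> \<bar>t' - t\<bar> < e \<Longrightarrow> susp_class x' t' \<in> V"
      using V x(1) unfolding openin_susp_top by meson
    \<comment> \<open>Besides the N coordinates demanded by V, the window contains all times within
      1 of t, so that nearby sequences share the time change there. \<open>M'\<close> is the window
      of the code that determines the digits up to M.\<close>
    define M where "M = max N (\<lceil>\<bar>t\<bar>\<rceil> + 1)"
    define M' where "M' = (int K + 1) * (M + 1)"
    have "M \<ge> 0" unfolding M_def by (simp add: le_max_iff_disj)
    then have "M' \<ge> 0" by (simp add: M'_def)
    \<comment> \<open>The added \<open>\<bar>m\<bar>\<close> compensates for the shift by m and
      ensures that \<open>y'\<close> also has its zero at \<open>- m\<close>.\<close>
    have "susp_class y' u' \<in> susp_code ` V"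
      if y': "y' \<in> ?Y" and agr: "agree (M' + \<bar>m\<bar>) y' y" and u': "\<bar>u' - u\<bar> < min e 1" for y' u'
    proof -
      have "y' (- m) = 0" using agr m \<open>M' \<ge> 0\<close> by (simp add: agree_def)
      then obtain x' where x': "x' \<in> X" "(\<lambda>j. y' (j - m)) = two_sided_code x'"
        using rep[OF y'] by blast
      have "agree M' (two_sided_code x') (two_sided_code x)"
        unfolding x(2)[symmetric] x'(2)[symmetric] agree_def
      proof (intro allI impI)
        fix j assume "\<bar>j\<bar> \<le> M'"
        then have "\<bar>j - m\<bar> \<le> M' + \<bar>m\<bar>" by linarith
        then show "y' (j - m) = y (j - m)" using agr unfolding agree_def by blast
      qed
      then have xx: "agree M x' x"
        unfolding M'_def by (rule agree_two_sided_codeD[of x' K x, OF bounded[OF x'(1)] bounded[OF x(1)]])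
      obtain t' where t': "time_change x t' = u' + of_int m" using surj_time_change by blast
      have "\<bar>t' - t\<bar> \<le> \<bar>time_change x t' - time_change x t\<bar>" by (rule abs_time_change_diff_ge)
      also have "\<dots> = \<bar>u' - u\<bar>" unfolding t' x(3)[symmetric] by simp
      finally have tt: "\<bar>t' - t\<bar> < e" "\<bar>t' - t\<bar> < 1" using u' by simp_all
      have "real_of_int (\<lceil>\<bar>t\<bar>\<rceil> + 1) \<le> of_int M" unfolding M_def by (simp only: of_int_le_iff max.cobounded2)
      then have "\<bar>t'\<bar> \<le> of_int M" using tt(2) by linarith
      then have "time_change x' t' = u' + of_int m" using time_change_agree[OF xx] t' by simp
      then have "susp_class y' u' = susp_class (two_sided_code x') (time_change x' t')"
        using classY[of y' m u'] unfolding x'(2) by simp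
      moreover have "susp_class x' t' \<in> V"
        using agree_mono[OF xx, of N] tt(1) by (intro Ne(2) x'(1)) (simp_all add: M_def)
      ultimately show ?thesis using mem[OF x'(1) VX] by simp
    qed
    then show "\<exists>N. \<exists>e>0. \<forall>y'\<in>?Y. \<forall>u'. agree N y' y \<longrightarrow> \<bar>u' - u\<bar> < e \<longrightarrow> susp_class y' u' \<in> susp_code ` V"
      using Ne(1) by (intro exI[of _ "M' + \<bar>m\<bar>"] exI[of _ "min e 1"]) auto
  qed
  have open_preimage: "openin (susp_top X) V"
    if VX: "V \<subseteq> susp_space X" and W: "openin (susp_top ?Y) (susp_code ` V)" for V
    unfolding openin_susp_top
  proof (intro conjI ballI allI impI)
    fix x t assume x: "x \<in> X" and "susp_class x t \<in> V"
    then have "susp_class (two_sided_code x) (time_change x t) \<in> susp_code ` V"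
      using mem[OF x VX] by blast
    then obtain N e where Ne: "e > 0"
      "\<And>y u. y \<in> ?Y \<Longrightarrow> agree N y (two_sided_code x) \<Longrightarrow> \<bar>u - time_change x t\<bar> < e
        \<Longrightarrow> susp_class y u \<in> susp_code ` V"
      using W two_sided_code_in_coded_shift[OF x] unfolding openin_susp_top by meson
    define M where "M = max N (\<lceil>\<bar>t\<bar>\<rceil> + 1)"
    \<comment> \<open>Dividing by the Lipschitz constant K + 1 keeps the changed times within e; the
      bound 1 keeps \<open>t'\<close> inside the window M.\<close>
    define e' where "e' = min 1 (e / (real K + 1))"
    have "e' > 0" using Ne(1) by (simp add: e'_def)
    have "susp_class x' t' \<in> V"
      if x': "x' \<in> X" and agr: "agree M x' x" and t': "\<bar>t' - t\<bar> < e'" for x' t'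
    proof -
      have "real_of_int (\<lceil>\<bar>t\<bar>\<rceil> + 1) \<le> of_int M" unfolding M_def by (simp only: of_int_le_iff max.cobounded2)
      moreover have "\<bar>t' - t\<bar> < 1" using t' by (simp add: e'_def)
      ultimately have "\<bar>t'\<bar> \<le> of_int M" by linarith
      then have e: "time_change x' t' = time_change x t'" by (rule time_change_agree[OF agr])
      have "\<bar>time_change x t' - time_change x t\<bar> \<le> (real K + 1) * \<bar>t' - t\<bar>"
        using bounded[OF x] by (rule abs_time_change_diff_le)
      also have "\<dots> < (real K + 1) * (e / (real K + 1))"
        using t' by (intro mult_strict_left_mono) (auto simp: e'_def)
      finally have "\<bar>time_change x' t' - time_change x t\<bar> < e" using e by simp
      moreover have "agree N (two_sided_code x') (two_sided_code x)"
        using agree_mono[OF agree_two_sided_code[OF agr], of N] by (simp add: M_def)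
      ultimately have "susp_class (two_sided_code x') (time_change x' t') \<in> susp_code ` V"
        by (intro Ne(2) two_sided_code_in_coded_shift x')
      then show ?thesis using mem[OF x' VX] by blast
    qed
    then show "\<exists>N. \<exists>e>0. \<forall>x'\<in>X. \<forall>t'. agree N x' x \<longrightarrow> \<bar>t' - t\<bar> < e \<longrightarrow> susp_class x' t' \<in> V"
      using \<open>e' > 0\<close> by blast
  qed (rule VX)
  have "homeomorphic_map (susp_top X) (susp_top ?Y) susp_code"
  proof (rule bijective_open_imp_homeomorphic_map)
    show "continuous_map (susp_top X) (susp_top ?Y) susp_code"
      unfolding continuous_map_def
    proof (intro conjI allI impI)
      show "susp_code \<in> topspace (susp_top X) \<rightarrow> topspace (susp_top ?Y)" using image by auto
      fix U assume U: "openin (susp_top ?Y) U"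
      have "U \<subseteq> susp_code ` susp_space X" using openin_subset[OF U] image by simp
      \<comment> \<open>Surjectivity makes U the image of its preimage, so
        \<open>open_preimage\<close> yields continuity.\<close>
      then have "susp_code ` {z \<in> susp_space X. susp_code z \<in> U} = U" by blast
      then show "openin (susp_top X) {z \<in> topspace (susp_top X). susp_code z \<in> U}"
        using U by (simp add: open_preimage)
    qed
    show "open_map (susp_top X) (susp_top ?Y) susp_code"
      using open_image by (simp add: open_map_def)
  qed (use inj image in auto)
  moreover have "\<exists>\<phi>. mono \<phi> \<and> (\<forall>r. susp_code (susp_add z r) = susp_add (susp_code z) (\<phi> r))"
    if zX: "z \<in> susp_space X" for z
  proof -
    obtain x t where z: "z = susp_class x t" using zX unfolding susp_space_def by blast
    have "mono (\<lambda>r. time_change x (t + r) - time_change x t)"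
      using mono_time_change[of x] by (simp add: mono_def)
    then show ?thesis
      unfolding z by (intro exI[of _ "\<lambda>r. time_change x (t + r) - time_change x t"])
        (simp add: susp_add_susp_class susp_code_susp_class)
  qed
  ultimately show ?thesis unfolding flow_equivalent_def by blast
qed

theorem theorem4p5:
  fixes \<beta> :: real
  assumes "\<beta> > 1"
  shows "\<exists>\<beta>'::real. 1 < \<beta>' \<and> \<beta>' < 2 \<and> flow_equivalent (beta_shift \<beta>) (beta_shift \<beta>')"
proof -
  obtain d where d: "quasi_greedy \<beta> d" using quasi_greedy_exists[OF assms] by blast
  then obtain \<beta>' where \<beta>': "1 < \<beta>'" "\<beta>' < 2" "quasi_greedy \<beta>' (unary_code d)"
    using quasi_greedy_unary_code by blast
  have "flow_equivalent (lex_shift d) (coded_shift (lex_shift d))"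
    using lex_shift_shift lex_shift_bounded by (rule flow_equivalent_coded_shift)
  then show ?thesis
    using d \<beta>' by (auto simp: quasi_greedy.beta_shift_eq lex_shift_unary_code)
qed

end
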